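(* Let $C$ be a finite cyclic group, let $K$ be a number field with ring of integers $\mathcal{O}_K$, and let $\chi:C\to K^*$ be a character of $C$ whose order $n>1$ is not a prime power. Let $\rho:C\to\mathrm{GL}_2(K)$ be the representation $\rho(g)=\begin{pmatrix}1&0\\0&\chi(g)\end{pmatrix}$ (the representation with character $1+\chi$). Then the number of $\mathrm{GL}_2(\mathcal{O}_K)$-conjugacy classes of homomorphisms $\phi:C\to\mathrm{GL}_2(\mathcal{O}_K)$ that are $\mathrm{GL}_2(K)$-conjugate to $\rho$ equals the class number $h_K$ of $K$.
   Context: A character $\chi$ "defined over $K$" means $\chi$ takes values in $K^*$; its order is its order in the group of characters of $C$. An "$\mathcal{O}_K$-representation" of $C$ is a homomorphism $C\to\mathrm{GL}_2(\mathcal{O}_K)$; two such are considered equivalent when conjugate by a matrix in $\mathrm{GL}_2(\mathcal{O}_K)$. $h_K$ denotes the order of the ideal class group of $K$. *)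

theory Defs
  imports
    "HOL-Analysis.Analysis"
    "HOL-Algebra.Elementary_Groups"
    "HOL-Algebra.Multiplicative_Group"
    "HOL-Number_Theory.Prime_Powers"
begin

section \<open>Number fields\<close>

text \<open>A number field is rendered as a type: a field of characteristic 0 that is
  finite-dimensional over the rationals, which act on it through \<^term>\<open>of_rat\<close>.\<close>

definition number_field :: "'k::field_char_0 itself \<Rightarrow> bool"
  where "number_field _ \<longleftrightarrow>
    (\<exists>B :: 'k set. finite B \<and> module.span (\<lambda>q x. of_rat q * x) B = UNIV)"

definition ring_of_integers :: "'k::field_char_0 set" (\<open>\<O>\<close>)
  where "\<O> = {x. algebraic_int x}"

definition unit_group :: "'k::field_char_0 monoid"
  where "unit_group = \<lparr>carrier = UNIV - {0}, mult = (*), one = 1\<rparr>"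


section \<open>The ideal class group\<close>

definition fractional_ideal :: "'k::field_char_0 set \<Rightarrow> bool"
  where "fractional_ideal I \<longleftrightarrow>
    0 \<in> I \<and> (\<forall>x\<in>I. \<forall>y\<in>I. x + y \<in> I) \<and> (\<forall>a\<in>\<O>. \<forall>x\<in>I. a * x \<in> I) \<and>
    (\<exists>d\<in>\<O>. d \<noteq> 0 \<and> (\<forall>x\<in>I. d * x \<in> \<O>))"

definition ideal_mult :: "'k::field_char_0 set \<Rightarrow> 'k set \<Rightarrow> 'k set"
  where "ideal_mult I J =
    {\<Sum>i<m. a i * b i | (m::nat) a b. (\<forall>i<m. a i \<in> I) \<and> (\<forall>i<m. b i \<in> J)}"

definition ideal_group :: "'k::field_char_0 set monoid"
  where "ideal_group =
    \<lparr>carrier = {I. fractional_ideal I \<and> I \<noteq> {0}}, mult = ideal_mult, one = \<O>\<rparr>"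

definition principal_ideals :: "'k::field_char_0 set set"
  where "principal_ideals = {(\<lambda>x. c * x) ` \<O> | c. c \<noteq> 0}"

definition class_group :: "'k::field_char_0 set set monoid"
  where "class_group = ideal_group Mod principal_ideals"

definition class_number :: "'k::field_char_0 itself \<Rightarrow> nat"
  where "class_number _ = Coset.order (class_group :: 'k set set monoid)"


section \<open>Characters and matrix representations\<close>

text \<open>Homomorphisms from \<open>C\<close> are made extensional (\<^term>\<open>undefined\<close> off the carrier), so
  that equality of functions is equality on \<open>C\<close>.\<close>

definition homs :: "('c, 'd) monoid_scheme \<Rightarrow> ('a, 'e) monoid_scheme \<Rightarrow> ('c \<Rightarrow> 'a) set"
  where "homs C G = hom C G \<inter> extensional (carrier C)"

definition character_group :: "('c, 'd) monoid_scheme \<Rightarrow> ('c \<Rightarrow> 'k::field_char_0) monoid"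
  where "character_group C =
    \<lparr>carrier = homs C unit_group,
     mult = (\<lambda>chi psi. \<lambda>g\<in>carrier C. chi g * psi g),
     one = (\<lambda>g\<in>carrier C. 1)\<rparr>"

text \<open>For a subring \<open>R\<close> of the field, the invertible matrices over \<open>R\<close>: both the matrix and its
  inverse have entries in \<open>R\<close>.\<close>

definition GL :: "'k::field_char_0 set \<Rightarrow> ('k^'n^'n) monoid"
  where "GL R =
    \<lparr>carrier = {A. (\<forall>i j. A $ i $ j \<in> R) \<and>
       (\<exists>B. (\<forall>i j. B $ i $ j \<in> R) \<and> A ** B = mat 1 \<and> B ** A = mat 1)},
     mult = (**), one = mat 1\<rparr>"

definition conjugate_in ::
    "('a, 'e) monoid_scheme \<Rightarrow> ('c, 'd) monoid_scheme \<Rightarrow> ('c \<Rightarrow> 'a) \<Rightarrow> ('c \<Rightarrow> 'a) \<Rightarrow> bool"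
  where "conjugate_in G C \<phi> \<psi> \<longleftrightarrow>
    (\<exists>P\<in>carrier G. \<forall>g\<in>carrier C. \<psi> g = P \<otimes>\<^bsub>G\<^esub> \<phi> g \<otimes>\<^bsub>G\<^esub> inv\<^bsub>G\<^esub> P)"

definition one_plus_char :: "('c \<Rightarrow> 'k::field_char_0) \<Rightarrow> 'c \<Rightarrow> 'k^2^2"
  where "one_plus_char chi g = vector [vector [1, 0], vector [0, chi g]]"

definition integral_forms ::
    "('c, 'd) monoid_scheme \<Rightarrow> ('c \<Rightarrow> 'k::field_char_0^2^2) \<Rightarrow> ('c \<Rightarrow> 'k^2^2) set"
  where "integral_forms C \<rho> = {\<phi> \<in> homs C (GL \<O>). conjugate_in (GL UNIV) C \<phi> \<rho>}"

definition integral_classes ::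
    "('c, 'd) monoid_scheme \<Rightarrow> ('c \<Rightarrow> 'k::field_char_0^2^2) \<Rightarrow> ('c \<Rightarrow> 'k^2^2) set set"
  where "integral_classes C \<rho> = integral_forms C \<rho> //
    {(\<phi>, \<psi>) \<in> integral_forms C \<rho> \<times> integral_forms C \<rho>. conjugate_in (GL \<O>) C \<phi> \<psi>}"

end

theory Submission
  imports Defs "Jordan_Normal_Form.Char_Poly"
begin

text \<open>Let \<open>g\<close> generate \<open>C\<close> and put \<open>\<zeta> = \<chi>(g)\<close>. Since the order of \<open>\<zeta>\<close> is not a prime power,
  \<open>1 - \<zeta>\<close> is a unit of \<open>\<O>\<close>, so the projection \<open>e\<close> onto the 1-eigenspace of an integral form
  has entries in \<open>\<O>\<close>. Writing \<open>e = u v\<^sup>T\<close> with \<open>v\<^sup>T u = 1\<close>, the class of the ideal generated by the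
  entries of \<open>v\<close> determines the form up to integral conjugation. Every class occurs
  because a nonzero fractional ideal \<open>I\<close> has elements \<open>v\<^sub>1, v\<^sub>2\<close> and multipliers \<open>u\<^sub>1, u\<^sub>2\<close> in \<open>(\<O> : I)\<close>
  with \<open>u\<^sub>1 v\<^sub>1 + u\<^sub>2 v\<^sub>2 = 1\<close>. The latter needs no prime ideals: all quotients \<open>\<O>/m\<O>\<close> are finite,
  so some power of each element is idempotent modulo \<open>m\<close>.\<close>

section \<open>Algebraic integers form a ring\<close>

text \<open>Integrality of the projection comes from the single relation
  \<open>(1 - \<zeta>) e = \<phi>(g) - \<zeta>\<close>, where only the factor
  \<open>1 - \<zeta>\<close> could introduce denominators. The projection fixes the pair (u, v) only
  up to (c^-1 u, c v), so the ideal of v is fixed only up to a principal factor: hence classes are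
  counted, not ideals. For the same reason u and v have entries in K; if both were integral, v u = 1
  would make the ideal trivial. Realising every class rests on the invertibility of ideals, which is
  drawn from two consequences of finite residue rings: a proper ideal of a finite ring has a nonzero
  annihilator, and \<open>\<O>\<close> is completely integrally closed. Finiteness of residue rings
  is in turn traced to the rational dimension of K, through integer relations that stay nontrivial
  modulo p.\<close>

lemma algebraic_int_eigenvalue:
  fixes A :: "int mat" and z :: "'a::field_char_0"
  assumes A: "A \<in> carrier_mat n n" and ev: "eigenvalue (map_mat of_int A) z"
  shows "algebraic_int z"
proof -
  have "map_mat of_int A \<in> carrier_mat n n"
    using A by simp
  then have "poly (char_poly (map_mat of_int A)) z = 0"
    using ev eigenvalue_root_char_poly by blast
  then have "poly (map_poly of_int (char_poly A)) z = 0"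
    by (simp add: of_int_hom.char_poly_hom[OF A])
  then show ?thesis
    using degree_monic_char_poly[OF A] by (auto simp: algebraic_int_altdef_ipoly)
qed

context
begin

interpretation int_mod: Modules.module "\<lambda>(c::int) (x::'a::comm_ring_1). of_int c * x"
  by standard (auto simp: algebra_simps)

text \<open>Determinant trick: multiplication by z on V is given by an integer matrix having the
  list of elements of V itself as an eigenvector. Only one nonzero entry is required, so
  dependencies within V do no harm.\<close>

lemma algebraic_int_if_stable:
  fixes z :: "'a::field_char_0"
  assumes V: "finite V" and nz: "w \<in> V" "w \<noteq> 0"
    and stable: "\<And>v. v \<in> V \<Longrightarrow> z * v \<in> int_mod.span V"
  shows "algebraic_int z"
proof -
  define n where "n = card V"
  obtain v where v: "bij_betw v {0..<n} V"
    using ex_bij_betw_nat_finite[OF V] n_def by blast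
  have "\<exists>c :: 'a \<Rightarrow> int. z * v i = (\<Sum>x\<in>V. of_int (c x) * x)" if "i < n" for i
  proof -
    have "z * v i \<in> int_mod.span V"
      using that v stable by (auto simp: bij_betw_def)
    then show ?thesis
      by (auto simp: int_mod.span_finite[OF V])
  qed
  then obtain c :: "nat \<Rightarrow> 'a \<Rightarrow> int"
    where c: "\<And>i. i < n \<Longrightarrow> z * v i = (\<Sum>x\<in>V. of_int (c i x) * x)"
    by metis
  define A where "A = mat n n (\<lambda>(i, j). c i (v j))"
  have A: "A \<in> carrier_mat n n"
    by (simp add: A_def)
  have "map_mat of_int A *\<^sub>v vec n v = z \<cdot>\<^sub>v vec n v"
  proof (rule eq_vecI)
    fix i assume "i < dim_vec (z \<cdot>\<^sub>v vec n v)"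
    then have i: "i < n" by simp
    have "(\<Sum>x\<in>V. of_int (c i x) * x) = (\<Sum>j\<in>{0..<n}. of_int (c i (v j)) * v j)"
      by (rule sum.reindex_bij_betw[OF v, symmetric])
    then show "vec_index (map_mat of_int A *\<^sub>v vec n v) i = vec_index (z \<cdot>\<^sub>v vec n v) i"
      using i c[OF i] by (simp add: A_def scalar_prod_def)
  qed (simp add: A_def)
  moreover obtain k where k: "k < n" "v k = w"
    using nz v by (force simp: bij_betw_def)
  then have "vec n v \<noteq> 0\<^sub>v n"
    using nz by (metis index_vec index_zero_vec(1))
  ultimately have "eigenvector (map_mat of_int A) (vec n v) z"
    by (simp add: eigenvector_def A_def)
  then show ?thesis
    using algebraic_int_eigenvalue[OF A] by (auto simp: eigenvalue_def)
qed

lemma algebraic_int_power_in_span: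
  fixes x :: "'a::field_char_0"
  assumes "algebraic_int x"
  obtains m where "m > 0" and "x ^ m \<in> int_mod.span ((\<lambda>i. x ^ i) ` {..<m})"
proof -
  obtain p :: "int poly" where p: "poly (map_poly of_int p) x = 0" "lead_coeff p = 1"
    using assms by (auto simp: algebraic_int_altdef_ipoly)
  define m where "m = degree p"
  have deg: "degree (map_poly of_int p :: 'a poly) = m"
    by (simp add: m_def)
  have m: "m > 0"
  proof (rule ccontr)
    assume "\<not> m > 0"
    then obtain a where "p = [:a:]"
      by (auto simp: m_def elim: degree_eq_zeroE)
    then have "p = 1"
      using p(2) by (simp add: one_pCons)
    then show False
      using p(1) by simp
  qed
  have "(\<Sum>i\<le>m. of_int (Polynomial.coeff p i) * x ^ i) = 0"
    using p(1) by (simp add: poly_altdef m_def coeff_map_poly)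
  then have "(\<Sum>i<m. of_int (Polynomial.coeff p i) * x ^ i) + x ^ m = 0"
    using p(2) by (simp add: m_def lessThan_Suc_atMost[symmetric])
  then have "x ^ m = - (\<Sum>i<m. of_int (Polynomial.coeff p i) * x ^ i)"
    by (simp add: eq_neg_iff_add_eq_0 add.commute)
  also have "\<dots> \<in> int_mod.span ((\<lambda>i. x ^ i) ` {..<m})"
    by (intro int_mod.span_neg int_mod.span_sum int_mod.span_scale int_mod.span_base) auto
  finally show thesis
    using m that by blast
qed

text \<open>One lattice serves both claims: the span of the products x^i y^j with i < m, j < n is
  stable under x and under y, hence under their sum and product.\<close>

lemma
  fixes x y :: "'a::field_char_0"
  assumes x: "algebraic_int x" and y: "algebraic_int y"
  shows algebraic_int_add: "algebraic_int (x + y)"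
    and algebraic_int_mult: "algebraic_int (x * y)"
proof -
  obtain m where m: "m > 0" "x ^ m \<in> int_mod.span ((\<lambda>i. x ^ i) ` {..<m})"
    using algebraic_int_power_in_span[OF x] .
  obtain n where n: "n > 0" "y ^ n \<in> int_mod.span ((\<lambda>i. y ^ i) ` {..<n})"
    using algebraic_int_power_in_span[OF y] .
  define V where "V = (\<lambda>(i, j). x ^ i * y ^ j) ` ({..<m} \<times> {..<n})"
  have V: "finite V" "1 \<in> V"
    using m n by (auto simp: V_def intro!: image_eqI[of _ _ "(0, 0)"])
  have memV: "x ^ i * y ^ j \<in> V" if "i < m" "j < n" for i j
    using that by (auto simp: V_def)
  have mult: "a * s \<in> int_mod.span V"
    if s: "s \<in> int_mod.span W" and W: "\<And>w. w \<in> W \<Longrightarrow> a * w \<in> int_mod.span V" for a s W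
    using s
  proof (induction rule: int_mod.span_induct_alt)
    case (step c w t)
    have "a * (of_int c * w + t) = of_int c * (a * w) + a * t"
      by (simp add: algebra_simps)
    then show ?case
      using step W by (auto intro!: int_mod.span_add int_mod.span_scale)
  qed (simp add: int_mod.span_zero)
  have xV: "x * v \<in> int_mod.span V" if v: "v \<in> V" for v
  proof -
    obtain i j where ij: "v = x ^ i * y ^ j" "i < m" "j < n"
      using v by (auto simp: V_def)
    \<comment> \<open>This settles the top exponent i = m - 1; for smaller i the product x v is
      again one of the generators.\<close>
    have "y ^ j * x ^ m \<in> int_mod.span V"
      using ij by (intro mult[OF m(2)]) (auto simp: mult.commute[of "y ^ j"] intro!: int_mod.span_base memV)
    moreover have "x ^ Suc i * y ^ j \<in> V" if "Suc i \<noteq> m"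
      using that ij by (intro memV) auto
    moreover have "x * v = x ^ Suc i * y ^ j"
      by (simp add: ij(1) mult.assoc)
    ultimately show ?thesis
      by (metis int_mod.span_base mult.commute)
  qed
  have yV: "y * v \<in> int_mod.span V" if v: "v \<in> V" for v
  proof -
    obtain i j where ij: "v = x ^ i * y ^ j" "i < m" "j < n"
      using v by (auto simp: V_def)
    have "x ^ i * y ^ n \<in> int_mod.span V"
      using ij by (intro mult[OF n(2)]) (auto intro!: int_mod.span_base memV)
    moreover have "x ^ i * y ^ Suc j \<in> V" if "Suc j \<noteq> n"
      using that ij by (intro memV) auto
    moreover have "y * v = x ^ i * y ^ Suc j"
      by (simp add: ij(1))
    ultimately show ?thesis
      by (metis int_mod.span_base)
  qed
  show "algebraic_int (x + y)"
    using V(1) V(2) by (rule algebraic_int_if_stable)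
      (auto simp: distrib_right intro!: int_mod.span_add xV yV)
  show "algebraic_int (x * y)"
    using V(1) V(2)
  proof (rule algebraic_int_if_stable)
    fix v assume "v \<in> V"
    then show "x * y * v \<in> int_mod.span V"
      using mult[OF yV xV] by (simp add: mult.assoc)
  qed simp
qed

lemma algebraic_int_if_power_relation:
  fixes z :: "'a::field_char_0" and c :: "nat \<Rightarrow> int"
  assumes zd: "z ^ d = (\<Sum>i<d. of_int (c i) * z ^ i)"
  shows "algebraic_int z"
proof (rule algebraic_int_if_stable)
  let ?V = "(\<lambda>i. z ^ i) ` {..<d}"
  have "d > 0"
    using zd by (cases d) auto
  then show "(1::'a) \<in> ?V"
    by (auto intro!: image_eqI[of _ _ 0])
  fix v assume "v \<in> ?V"
  then obtain i where i: "i < d" "v = z ^ i" by auto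
  show "z * v \<in> int_mod.span ?V"
  proof (cases "Suc i = d")
    case True
    then have "z * v = (\<Sum>i<d. of_int (c i) * z ^ i)"
      using i zd by auto
    also have "\<dots> \<in> int_mod.span ?V"
      by (intro int_mod.span_sum int_mod.span_scale int_mod.span_base) auto
    finally show ?thesis .
  next
    case False
    then have "Suc i < d" using i by simp
    then show ?thesis
      unfolding i(2) power_Suc[symmetric] by (intro int_mod.span_base imageI) simp
  qed
qed auto

end

section \<open>Finiteness of residue rings\<close>

lemma O_0 [simp]: "0 \<in> \<O>" and O_1 [simp]: "1 \<in> \<O>"
  and O_of_int [simp]: "of_int k \<in> \<O>" and O_of_nat [simp]: "of_nat m \<in> \<O>"
  by (simp_all add: ring_of_integers_def)

lemma O_add [intro, simp]: "x \<in> \<O> \<Longrightarrow> y \<in> \<O> \<Longrightarrow> x + y \<in> \<O>"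
  and O_mult [intro, simp]: "x \<in> \<O> \<Longrightarrow> y \<in> \<O> \<Longrightarrow> x * y \<in> \<O>"
  and O_minus [intro, simp]: "x \<in> \<O> \<Longrightarrow> - x \<in> \<O>"
  by (simp_all add: ring_of_integers_def algebraic_int_add algebraic_int_mult)

lemma O_diff [intro, simp]: "x \<in> \<O> \<Longrightarrow> y \<in> \<O> \<Longrightarrow> x - y \<in> \<O>"
  using O_add[of x "- y"] by simp

lemma O_power [intro, simp]: "x \<in> \<O> \<Longrightarrow> x ^ n \<in> \<O>"
  by (induction n) auto

lemma O_sum [intro]: "(\<And>i. i \<in> A \<Longrightarrow> f i \<in> \<O>) \<Longrightarrow> sum f A \<in> \<O>"
  by (induction A rule: infinite_finite_induct) auto

text \<open>The polynomial X^j - X^i is monic of positive degree. With i = 0 this also gives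
  integrality of roots of unity.\<close>

lemma O_if_power_diff:
  assumes "x ^ j - x ^ i \<in> \<O>" and "i < j"
  shows "x \<in> \<O>"
proof -
  define p where "p = Polynomial.monom (1::'a) j - Polynomial.monom 1 i"
  have coeff: "Polynomial.coeff p k = (if k = j then 1 else 0) - (if k = i then 1 else 0)" for k
    by (simp add: p_def)
  then have deg: "degree p = j"
    using assms(2) by (intro antisym degree_le le_degree) auto
  have "\<forall>k. Polynomial.coeff p k \<in> \<int>"
    by (simp add: coeff)
  moreover have "lead_coeff p = 1" "degree p > 0"
    using assms(2) by (simp_all add: deg coeff)
  moreover have "poly p x = x ^ j - x ^ i"
    by (simp add: p_def poly_monom)
  ultimately show ?thesis
    using assms(1) algebraic_int_root[of "x ^ j - x ^ i" p x] by (simp add: ring_of_integers_def)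
qed

section \<open>Integer relations from finite rational dimension\<close>

lemma common_denominator:
  fixes q :: "'i \<Rightarrow> rat"
  assumes "finite I"
  shows "\<exists>d::int. d \<noteq> 0 \<and> (\<forall>i\<in>I. of_int d * q i \<in> \<int>)"
  using assms
proof induction
  case empty
  show ?case by (intro exI[of _ 1]) simp
next
  case (insert i I)
  then obtain d :: int where d: "d \<noteq> 0" "\<forall>i\<in>I. of_int d * q i \<in> \<int>" by auto
  obtain a b where ab: "quotient_of (q i) = (a, b)"
    by fastforce
  then have b: "b > 0" "q i = of_int a / of_int b"
    using quotient_of_denom_pos quotient_of_div by blast+
  have "of_int (d * b) * q j = of_int b * (of_int d * q j)" for j
    by simp
  moreover have "of_int (d * b) * q i = of_int (d * a)"
    using b by simp
  ultimately have "\<forall>j\<in>insert i I. of_int (d * b) * q j \<in> \<int>"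
    using d by (metis Ints_mult Ints_of_int insertE)
  then show ?case
    using b(1) d(1) by (intro exI[of _ "d * b"]) simp
qed

text \<open>With a spanning set of n elements, any n + 1 are dependent over the rationals, and
  denominators can be cleared. That n is uniform in x is what later bounds the dimension of
  \<open>\<O>\<close> modulo p.\<close>

lemma integer_relation:
  assumes "number_field TYPE('k::field_char_0)"
  obtains n :: nat where
    "\<And>x :: nat \<Rightarrow> 'k. \<exists>c :: nat \<Rightarrow> int. (\<exists>i\<le>n. c i \<noteq> 0) \<and> (\<Sum>i\<le>n. of_int (c i) * x i) = 0"
proof -
  interpret rat_vs: vector_space "\<lambda>(q::rat) (x::'k). of_rat q * x"
    by standard (auto simp: algebra_simps of_rat_add of_rat_mult)
  obtain B :: "'k set" where B: "finite B" "rat_vs.span B = UNIV"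
    using assms by (auto simp: number_field_def)
  define n where "n = card B"
  have "\<exists>c :: nat \<Rightarrow> int. (\<exists>i\<le>n. c i \<noteq> 0) \<and> (\<Sum>i\<le>n. of_int (c i) * x i) = 0" for x :: "nat \<Rightarrow> 'k"
  proof (cases "inj_on x {..n}")
    case True
    then have "card (x ` {..n}) > card B"
      by (simp add: card_image n_def)
    then have "rat_vs.dependent (x ` {..n})"
      using rat_vs.independent_span_bound[OF B(1), of "x ` {..n}"] B(2) by auto
    then obtain u where u: "\<exists>v\<in>x ` {..n}. u v \<noteq> 0" "(\<Sum>v\<in>x ` {..n}. of_rat (u v) * v) = 0"
      by (auto simp: rat_vs.dependent_finite)
    obtain d :: int where d: "d \<noteq> 0" "\<forall>i\<in>{..n}. of_int d * u (x i) \<in> \<int>"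
      using common_denominator[of "{..n}" "\<lambda>i. u (x i)"] by auto
    then have "\<forall>i\<in>{..n}. \<exists>k::int. of_int d * u (x i) = of_int k"
      by (auto elim!: Ints_cases)
    then obtain c :: "nat \<Rightarrow> int" where c: "\<forall>i\<in>{..n}. of_int d * u (x i) = of_int (c i)"
      using bchoice by metis
    have "(\<Sum>i\<le>n. of_int (c i) * x i) = (\<Sum>i\<le>n. of_rat (of_int d * u (x i)) * x i)"
      using c by (intro sum.cong) (auto simp del: of_rat_mult simp: of_rat_of_int_eq)
    also have "\<dots> = of_int d * (\<Sum>i\<le>n. of_rat (u (x i)) * x i)"
      by (simp add: of_rat_mult sum_distrib_left mult.assoc)
    also have "(\<Sum>i\<le>n. of_rat (u (x i)) * x i) = (\<Sum>v\<in>x ` {..n}. of_rat (u v) * v)"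
      by (simp add: sum.reindex[OF True])
    finally have "(\<Sum>i\<le>n. of_int (c i) * x i) = 0"
      using u(2) by simp
    moreover obtain i where "i \<le> n" "u (x i) \<noteq> 0"
      using u(1) by auto
    then have "c i \<noteq> 0"
      using c d(1) by (metis atMost_iff mult_eq_0_iff of_int_eq_0_iff)
    ultimately show ?thesis
      using \<open>i \<le> n\<close> by blast
  next
    case False
    \<comment> \<open>Dependence is a notion for sets, so a repeated value is treated apart:
      coefficients 1 and -1 at its two indices.\<close>
    then obtain i j where ij: "i \<le> n" "j \<le> n" "i \<noteq> j" "x i = x j"
      by (auto simp: inj_on_def)
    define c :: "nat \<Rightarrow> int" where "c k = (if k = i then 1 else 0) - (if k = j then 1 else 0)" for k
    have "of_int (c k) * x k = (if k = i then x i else 0) - (if k = j then x j else 0)" for k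
      by (simp add: c_def)
    then have "(\<Sum>k\<le>n. of_int (c k) * x k) = 0"
      using ij by (simp add: sum_subtractf)
    moreover have "c i \<noteq> 0"
      using ij by (simp add: c_def)
    ultimately show ?thesis
      using ij by blast
  qed
  then show thesis
    using that by blast
qed

text \<open>Dividing by the gcd of the coefficients keeps the relation nontrivial after reduction
  modulo p.\<close>

lemma primitive_relation:
  fixes c :: "nat \<Rightarrow> int" and x :: "nat \<Rightarrow> 'k::field_char_0"
  assumes c: "\<exists>i\<le>n. c i \<noteq> 0" "(\<Sum>i\<le>n. of_int (c i) * x i) = 0" and p: "prime p"
  obtains c' :: "nat \<Rightarrow> int" where "\<exists>i\<le>n. \<not> p dvd c' i" "(\<Sum>i\<le>n. of_int (c' i) * x i) = 0"
proof -
  define g where "g = Gcd (c ` {..n})"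
  have g: "g \<noteq> 0"
    using c(1) by (auto simp: g_def)
  have cg: "c i = g * (c i div g)" if "i \<le> n" for i
    using that by (auto simp: g_def)
  have "\<exists>i\<le>n. \<not> p dvd c i div g"
  proof (rule ccontr)
    assume "\<not> (\<exists>i\<le>n. \<not> p dvd c i div g)"
    then have "g * p dvd c i" if "i \<le> n" for i
      using that cg by (metis dvd_refl mult_dvd_mono)
    then have "g * p dvd g"
      unfolding g_def by (intro Gcd_greatest) (auto simp: g_def)
    then show False
      using g p by (metis dvd_mult_cancel_left mult.right_neutral not_prime_unit)
  qed
  moreover have "of_int g * (\<Sum>i\<le>n. of_int (c i div g) * x i) = (\<Sum>i\<le>n. of_int (c i) * x i)"
    unfolding sum_distrib_left using cg
    by (intro sum.cong) (auto simp: mult.assoc[symmetric] simp flip: of_int_mult)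
  ultimately show thesis
    using g c(2) that by auto
qed

text \<open>Finiteness of \<open>\<O>\<close>/a\<open>\<O>\<close> through a finite, possibly
  redundant set of representatives, so that no quotient ring has to be formed.\<close>

definition finite_residues :: "'k::field_char_0 \<Rightarrow> bool"
  where "finite_residues a \<longleftrightarrow> (\<exists>F. finite F \<and> F \<subseteq> \<O> \<and> (\<forall>x\<in>\<O>. \<exists>f\<in>F. \<exists>y\<in>\<O>. x = f + a * y))"

text \<open>Since integer relations can be made primitive, at most \<open>n\<close> integers of \<open>K\<close> are independent
  modulo \<open>p\<close>, where \<open>n\<close> bounds the degree; a maximal independent family spans \<open>\<O>/p\<O>\<close>.\<close>

lemma finite_residues_prime:
  fixes p :: nat
  assumes K: "number_field TYPE('k::field_char_0)" and p: "prime p"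
  shows "finite_residues (of_nat p :: 'k)"
proof -
  obtain n where rel: "\<And>x :: nat \<Rightarrow> 'k. \<exists>c :: nat \<Rightarrow> int.
      (\<exists>i\<le>n. c i \<noteq> 0) \<and> (\<Sum>i\<le>n. of_int (c i) * x i) = 0"
    using integer_relation[OF K] by blast
  have ip: "prime (int p)"
    using p by simp
  \<comment> \<open>Linear independence over the field with p elements of the images in
    \<open>\<O>\<close>/p\<open>\<O>\<close>, phrased with integer coefficients.\<close>
  define indep where "indep k x \<longleftrightarrow> (\<forall>i<k. x i \<in> \<O>) \<and>
    (\<forall>c :: nat \<Rightarrow> int. \<forall>y\<in>\<O>. (\<Sum>i<k. of_int (c i) * x i) = of_nat p * y \<longrightarrow> (\<forall>i<k. int p dvd c i))"
    for k and x :: "nat \<Rightarrow> 'k"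
  have bound: "k \<le> n" if ind: "indep k x" for k x
  proof (rule ccontr)
    assume k: "\<not> k \<le> n"
    obtain c' :: "nat \<Rightarrow> int" where c': "\<exists>i\<le>n. c' i \<noteq> 0" "(\<Sum>i\<le>n. of_int (c' i) * x i) = 0"
      using rel by blast
    obtain c where c: "\<exists>i\<le>n. \<not> int p dvd c i" "(\<Sum>i\<le>n. of_int (c i) * x i) = 0"
      using primitive_relation[OF c' ip] .
    \<comment> \<open>The relation involves n + 1 elements, the family k of them; it is padded by
      zeros.\<close>
    define c0 where "c0 i = (if i \<le> n then c i else 0)" for i
    have "(\<Sum>i<k. of_int (c0 i) * x i) = (\<Sum>i\<le>n. of_int (c i) * x i)"
      using k by (intro sum.mono_neutral_cong_right) (simp_all add: c0_def not_le subset_eq)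
    then have "(\<Sum>i<k. of_int (c0 i) * x i) = of_nat p * 0"
      using c(2) by simp
    then have "\<forall>i<k. int p dvd c0 i"
      using ind O_0 unfolding indep_def by blast
    moreover obtain i where "i \<le> n" "\<not> int p dvd c i"
      using c(1) by blast
    moreover from this have "i < k" "c0 i = c i"
      using k by (simp_all add: c0_def)
    ultimately show False
      by metis
  qed
  define k where "k = (GREATEST k. \<exists>x. indep k x)"
  have "\<exists>x. indep 0 x"
    by (simp add: indep_def)
  then have k: "\<exists>x. indep k x" "\<And>j x. indep j x \<Longrightarrow> j \<le> k"
    unfolding k_def using GreatestI_nat[of "\<lambda>k. \<exists>x. indep k x" 0 n] bound
      Greatest_le_nat[of "\<lambda>k. \<exists>x. indep k x" _ n] by metis+
  then obtain x where x: "indep k x" by blast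
  define F where "F = (\<lambda>d. \<Sum>i<k. of_int (d i) * x i) ` (PiE {..<k} (\<lambda>_. {0..<int p}))"
  have "\<exists>f\<in>F. \<exists>z\<in>\<O>. y = f + of_nat p * z" if y: "y \<in> \<O>" for y
  proof -
    \<comment> \<open>Maximality of k: appending y destroys independence.\<close>
    have "\<not> indep (Suc k) (x(k := y))"
      using k(2)[of "Suc k"] by auto
    moreover have "\<forall>i<Suc k. (x(k := y)) i \<in> \<O>"
      using x y by (simp add: indep_def less_Suc_eq)
    ultimately obtain c :: "nat \<Rightarrow> int" and z i where c: "z \<in> \<O>"
        "(\<Sum>i<Suc k. of_int (c i) * (x(k := y)) i) = of_nat p * z" and i: "i < Suc k" "\<not> int p dvd c i"
      unfolding indep_def by blast
    have sum: "(\<Sum>i<k. of_int (c i) * x i) + of_int (c k) * y = of_nat p * z"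
      using c(2) by (simp add: lessThan_Suc algebra_simps)
    \<comment> \<open>Otherwise the term in y could be absorbed into the multiple of p, leaving a
      forbidden relation among the old elements.\<close>
    have "\<not> int p dvd c k"
    proof
      assume "int p dvd c k"
      then obtain d where d: "c k = int p * d" ..
      have "(\<Sum>i<k. of_int (c i) * x i) = of_nat p * (z - of_int d * y)"
        using sum by (simp add: d algebra_simps)
      moreover have "z - of_int d * y \<in> \<O>"
        using c(1) y by simp
      ultimately have "\<forall>i<k. int p dvd c i"
        using x unfolding indep_def by blast
      then show False
        using i \<open>int p dvd c k\<close> less_Suc_eq by blast
    qed
    then have "coprime (c k) (int p)"
      using ip by (simp add: coprime_commute prime_imp_coprime)
    then obtain a b where ab: "a * c k + b * int p = 1"
      using bezout_int[of "c k" "int p"] by auto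
    have one: "of_int a * of_int (c k) + of_int b * of_nat p = (1::'k)"
      using arg_cong[OF ab, of "of_int :: int \<Rightarrow> 'k"] by simp
    \<comment> \<open>Since a inverts \<open>c k\<close> modulo p, solving the relation for y gives
      these coefficients; their remainders modulo p then select an element of F.\<close>
    define e where "e i = - a * c i" for i
    have "of_int (e i) = of_int (e i mod int p) + of_nat p * (of_int (e i div int p) :: 'k)" for i
      using arg_cong[OF mod_mult_div_eq[of "e i" "int p", symmetric], of "of_int :: int \<Rightarrow> 'k"]
      by (simp only: of_int_add of_int_mult of_int_of_nat_eq)
    then have "of_int (e i) * x i = of_int (e i mod int p) * x i + of_nat p * (of_int (e i div int p) * x i)" for i
      by (metis distrib_right mult.assoc)
    then have "(\<Sum>i<k. of_int (e i) * x i) =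
        (\<Sum>i<k. of_int (e i mod int p) * x i) + of_nat p * (\<Sum>i<k. of_int (e i div int p) * x i)"
      by (simp only: sum_distrib_left sum.distrib)
    moreover have "of_int (e i) * x i = - of_int a * (of_int (c i) * x i)" for i
      by (simp only: e_def of_int_mult of_int_minus mult.assoc)
    then have "(\<Sum>i<k. of_int (e i) * x i) = - of_int a * (\<Sum>i<k. of_int (c i) * x i)"
      by (simp only: sum_distrib_left)
    moreover have "y = - of_int a * (\<Sum>i<k. of_int (c i) * x i) + of_nat p * (of_int a * z + of_int b * y)"
    proof -
      have "y = (of_int a * of_int (c k) + of_int b * of_nat p) * y"
        by (simp only: one mult_1)
      also have "\<dots> = of_int a * (of_nat p * z - (\<Sum>i<k. of_int (c i) * x i)) + of_int b * of_nat p * y"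
        by (simp only: sum[symmetric] distrib_right mult.assoc add_diff_cancel_left' mult.left_commute)
      finally show ?thesis
        by (simp only: algebra_simps mult_minus_left diff_conv_add_uminus minus_mult_right)
    qed
    ultimately have "y = (\<Sum>i<k. of_int (e i mod int p) * x i) +
        of_nat p * ((\<Sum>i<k. of_int (e i div int p) * x i) + (of_int a * z + of_int b * y))"
      by (simp add: algebra_simps)
    moreover have "(\<Sum>i<k. of_int (e i div int p) * x i) + (of_int a * z + of_int b * y) \<in> \<O>"
      using c(1) y x by (auto simp: indep_def intro!: O_add O_sum O_mult)
    moreover have "(\<Sum>i<k. of_int (e i mod int p) * x i) \<in> F"
      unfolding F_def using p
      by (intro image_eqI[of _ _ "\<lambda>i\<in>{..<k}. e i mod int p"]) (simp_all add: prime_gt_0_nat restrict_PiE_iff)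
    ultimately show ?thesis
      by blast
  qed
  moreover have "finite F"
    by (auto simp: F_def intro!: finite_PiE)
  moreover have "F \<subseteq> \<O>"
    using x by (auto simp: F_def indep_def intro!: O_sum O_mult)
  ultimately show ?thesis
    unfolding finite_residues_def by blast
qed

text \<open>A two-digit expansion: first digit modulo a, second digit modulo b.\<close>

lemma finite_residues_mult:
  assumes "finite_residues a" and "finite_residues b" and "a \<in> \<O>"
  shows "finite_residues (a * b)"
proof -
  obtain F G where F: "finite F" "F \<subseteq> \<O>" "\<forall>x\<in>\<O>. \<exists>f\<in>F. \<exists>y\<in>\<O>. x = f + a * y"
    and G: "finite G" "G \<subseteq> \<O>" "\<forall>x\<in>\<O>. \<exists>g\<in>G. \<exists>y\<in>\<O>. x = g + b * y"
    using assms unfolding finite_residues_def by blast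
  define H where "H = (\<lambda>(f, g). f + a * g) ` (F \<times> G)"
  have "\<exists>h\<in>H. \<exists>y\<in>\<O>. x = h + a * b * y" if x: "x \<in> \<O>" for x
  proof -
    obtain f y where f: "f \<in> F" "y \<in> \<O>" "x = f + a * y"
      using F x by blast
    obtain g z where g: "g \<in> G" "z \<in> \<O>" "y = g + b * z"
      using G f by blast
    have "f + a * g \<in> H"
      using f g by (auto simp: H_def)
    moreover have "x = (f + a * g) + a * b * z"
      using f g by (simp add: algebra_simps)
    ultimately show ?thesis
      using g(2) by blast
  qed
  moreover have "finite H" "H \<subseteq> \<O>"
    using F G assms(3) by (auto simp: H_def intro!: O_add O_mult)
  ultimately show ?thesis
    unfolding finite_residues_def by blast
qed

lemma finite_residues_of_nat:
  assumes K: "number_field TYPE('k::field_char_0)" and "m > 0"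
  shows "finite_residues (of_nat m :: 'k)"
  using \<open>m > 0\<close>
proof (induction m rule: less_induct)
  case (less m)
  show ?case
  proof (cases "m = 1")
    case True
    then show ?thesis
      unfolding finite_residues_def by (intro exI[of _ "{0}"]) auto
  next
    case False
    then obtain p m' where p: "prime p" "m = p * m'"
      using prime_factor_nat by (metis dvdE)
    then have "m' > 0" "m' < m"
      using less.prems prime_gt_1_nat[OF p(1)] by auto
    then show ?thesis
      using finite_residues_mult[OF finite_residues_prime[OF K p(1)] less.IH] p(2) by simp
  qed
qed

text \<open>A relation among powers of x with leading coefficient l becomes monic in l x after
  multiplication by l^(d-1); t is the absolute value of l.\<close>

lemma integral_multiple:
  fixes x :: "'k::field_char_0"
  assumes K: "number_field TYPE('k)"
  obtains t :: nat where "t > 0" "of_nat t * x \<in> \<O>"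
proof -
  obtain n where rel: "\<And>x :: nat \<Rightarrow> 'k. \<exists>c :: nat \<Rightarrow> int.
      (\<exists>i\<le>n. c i \<noteq> 0) \<and> (\<Sum>i\<le>n. of_int (c i) * x i) = 0"
    using integer_relation[OF K] by blast
  obtain c :: "nat \<Rightarrow> int" where c: "\<exists>i\<le>n. c i \<noteq> 0" "(\<Sum>i\<le>n. of_int (c i) * x ^ i) = 0"
    using rel by blast
  define d where "d = Max {i. i \<le> n \<and> c i \<noteq> 0}"
  have "d \<in> {i. i \<le> n \<and> c i \<noteq> 0}"
    unfolding d_def using c(1) by (intro Max_in) auto
  then have d: "d \<le> n" "c d \<noteq> 0" by auto
  have dmax: "c i = 0" if "i \<le> n" "i > d" for i
  proof (rule ccontr)
    assume "c i \<noteq> 0"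
    then have "i \<le> d"
      unfolding d_def using that(1) by (intro Max_ge) auto
    then show False using that(2) by simp
  qed
  define l where "l = c d"
  define z where "z = of_int l * x"
  have "(\<Sum>i\<le>n. of_int (c i) * x ^ i) = (\<Sum>i\<le>d. of_int (c i) * x ^ i)"
    using d dmax by (intro sum.mono_neutral_right) auto
  then have low: "(\<Sum>i<d. of_int (c i) * x ^ i) = - (of_int l * x ^ d)"
    using c(2) by (simp add: l_def lessThan_Suc_atMost[symmetric] eq_neg_iff_add_eq_0)
  \<comment> \<open>For d = 0 the relation would say l = 0.\<close>
  have d0: "d > 0"
    using low d(2) by (cases d) (auto simp: l_def)
  have "z ^ d = of_int l ^ (d - 1) * (of_int l * x ^ d)"
    using d0 by (cases d) (auto simp: z_def power_mult_distrib)
  also have "\<dots> = - (of_int l ^ (d - 1) * (\<Sum>i<d. of_int (c i) * x ^ i))"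
    by (simp add: low)
  also have "\<dots> = (\<Sum>i<d. of_int (- c i * l ^ (d - 1 - i)) * z ^ i)"
  proof -
    have "- (of_int l ^ (d - 1) * (of_int (c i) * x ^ i)) = of_int (- c i * l ^ (d - 1 - i)) * z ^ i"
      if "i < d" for i
    proof -
      have "d - 1 = (d - 1 - i) + i" using that by simp
      then have "(of_int l :: 'k) ^ (d - 1) = of_int l ^ (d - 1 - i) * of_int l ^ i"
        by (metis power_add)
      then show ?thesis
        by (simp add: z_def power_mult_distrib)
    qed
    then show ?thesis
      unfolding sum_distrib_left sum_negf[symmetric] by (intro sum.cong) simp_all
  qed
  finally have "algebraic_int z"
    by (rule algebraic_int_if_power_relation)
  then have "z \<in> \<O>"
    by (simp add: ring_of_integers_def)
  moreover have "of_nat (nat \<bar>l\<bar>) * x = z \<or> of_nat (nat \<bar>l\<bar>) * x = - z"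
    by (cases "l \<ge> 0") (auto simp: z_def)
  ultimately have "of_nat (nat \<bar>l\<bar>) * x \<in> \<O>"
    by auto
  then show thesis
    using d(2) that[of "nat \<bar>l\<bar>"] by (simp add: l_def)
qed

text \<open>If t/a is integral, then t\<open>\<O>\<close> lies in a\<open>\<O>\<close>, so
  representatives modulo t also serve modulo a.\<close>

lemma finite_residues:
  fixes a :: "'k::field_char_0"
  assumes K: "number_field TYPE('k)" and "a \<noteq> 0"
  shows "finite_residues a"
proof -
  obtain t :: nat where t: "t > 0" "of_nat t * inverse a \<in> \<O>"
    using integral_multiple[OF K] .
  have eq: "of_nat t * y = a * (of_nat t * inverse a * y)" for y
    using \<open>a \<noteq> 0\<close> by simp
  have "\<exists>z\<in>\<O>. of_nat t * y = a * z" if "y \<in> \<O>" for y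
    using that t(2) eq[of y] by blast
  then show ?thesis
    using finite_residues_of_nat[OF K t(1)] unfolding finite_residues_def by metis
qed

section \<open>Fractional ideals are invertible and generated by two elements\<close>

text \<open>Congruence modulo m\<open>\<O>\<close> on all of K, with m allowed to be fractional;
  compatibility with products therefore asks for integral multipliers.\<close>

definition O_cong :: "'k::field_char_0 \<Rightarrow> 'k \<Rightarrow> 'k \<Rightarrow> bool"
  where "O_cong m x y \<longleftrightarrow> (\<exists>t\<in>\<O>. x = y + m * t)"

lemma O_cong_refl [simp]: "O_cong m x x"
  unfolding O_cong_def by (intro bexI[of _ 0]) auto

lemma O_cong_eq_diff: "O_cong m x y \<longleftrightarrow> O_cong m (x - y) 0"
  by (simp add: O_cong_def algebra_simps)

lemma O_cong_self [simp]: "O_cong m m 0"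
  unfolding O_cong_def by (intro bexI[of _ 1]) auto

lemma O_cong_sym: "O_cong m x y \<Longrightarrow> O_cong m y x"
  unfolding O_cong_def by (metis O_minus add_diff_cancel_right' diff_conv_add_uminus mult_minus_right)

lemma O_cong_trans [trans]:
  assumes "O_cong m x y" and "O_cong m y z"
  shows "O_cong m x z"
proof -
  obtain s t where "s \<in> \<O>" "x = y + m * s" "t \<in> \<O>" "y = z + m * t"
    using assms by (auto simp: O_cong_def)
  then show ?thesis
    unfolding O_cong_def by (intro bexI[of _ "s + t"]) (auto simp: algebra_simps)
qed

lemma O_cong_add:
  assumes "O_cong m x x'" and "O_cong m y y'"
  shows "O_cong m (x + y) (x' + y')"
proof -
  obtain s t where "s \<in> \<O>" "x = x' + m * s" "t \<in> \<O>" "y = y' + m * t"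
    using assms by (auto simp: O_cong_def)
  then show ?thesis
    unfolding O_cong_def by (intro bexI[of _ "s + t"]) (auto simp: algebra_simps)
qed

lemma O_cong_mult_left:
  assumes "O_cong m x y" and "r \<in> \<O>"
  shows "O_cong m (r * x) (r * y)"
proof -
  obtain t where "t \<in> \<O>" "x = y + m * t"
    using assms by (auto simp: O_cong_def)
  then show ?thesis
    unfolding O_cong_def using assms(2) by (intro bexI[of _ "r * t"]) (auto simp: algebra_simps)
qed

lemma O_cong_mult_right: "O_cong m x y \<Longrightarrow> r \<in> \<O> \<Longrightarrow> O_cong m (x * r) (y * r)"
  using O_cong_mult_left[of m x y r] by (simp add: mult.commute)

lemma O_cong_mult:
  assumes "O_cong m x x'" and "O_cong m y y'" and "x \<in> \<O>" and "y' \<in> \<O>"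
  shows "O_cong m (x * y) (x' * y')"
  using O_cong_mult_left[OF assms(2,3)] O_cong_mult_right[OF assms(1,4)] by (rule O_cong_trans)

section \<open>Consequences of finite residue rings\<close>

lemma O_pigeonhole:
  assumes "finite_residues m" and "\<And>i::nat. s i \<in> \<O>"
  obtains i j where "i < j" "O_cong m (s j) (s i)"
proof -
  obtain F where F: "finite F" "\<forall>x\<in>\<O>. \<exists>f\<in>F. \<exists>y\<in>\<O>. x = f + m * y"
    using assms(1) unfolding finite_residues_def by blast
  have "\<forall>i. \<exists>f. f \<in> F \<and> O_cong m (s i) f"
    using F(2) assms(2) unfolding O_cong_def by blast
  then obtain f where f: "\<And>i. f i \<in> F" "\<And>i. O_cong m (s i) (f i)"
    by metis
  have "\<not> inj f"
    using F(1) f(1) by (meson finite_imageD finite_subset image_subsetI infinite_UNIV_nat)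
  then obtain i j where "i \<noteq> j" "f i = f j"
    by (auto simp: inj_def)
  then have "O_cong m (s i) (s j)" "O_cong m (s j) (s i)"
    using f(2) by (metis O_cong_sym O_cong_trans)+
  with \<open>i \<noteq> j\<close> show thesis
    using that[of i j] that[of j i] by (auto simp: neq_iff)
qed

text \<open>By the pigeonhole principle modulo \<open>c\<close>, \<open>x\<close> is a root of some \<open>X\<^sup>j - X\<^sup>i - t\<close> with \<open>t\<close> integral.\<close>

lemma completely_integrally_closed:
  fixes x :: "'k::field_char_0"
  assumes K: "number_field TYPE('k)" and "c \<noteq> 0" and "\<And>k. c * x ^ k \<in> \<O>"
  shows "x \<in> \<O>"
proof -
  obtain i j where ij: "i < j" "O_cong c (c * x ^ j) (c * x ^ i)"
    using O_pigeonhole[OF finite_residues[OF K assms(2)], of "\<lambda>k. c * x ^ k"] assms(3) by blast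
  then obtain t where t: "t \<in> \<O>" "c * x ^ j = c * x ^ i + c * t"
    by (auto simp: O_cong_def)
  then have "c * (x ^ j - x ^ i) = c * t"
    by (simp add: algebra_simps)
  then have "x ^ j - x ^ i \<in> \<O>"
    using assms(2) t(1) by simp
  then show ?thesis
    using ij(1) by (rule O_if_power_diff)
qed

lemma idempotent_power:
  assumes fr: "finite_residues m" and s: "s \<in> \<O>"
  obtains N where "N > 0" "O_cong m (s ^ N * s ^ N) (s ^ N)"
proof -
  obtain i j where ij: "i < j" "O_cong m (s ^ j) (s ^ i)"
    using O_pigeonhole[OF fr, of "\<lambda>k. s ^ k"] s by blast
  define d where "d = j - i"
  have period: "O_cong m (s ^ (k + d)) (s ^ k)" if "k \<ge> i" for k
  proof -
    have "s ^ (k + d) = s ^ (k - i) * s ^ j" "s ^ k = s ^ (k - i) * s ^ i"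
      using that ij(1) by (simp_all add: d_def flip: power_add)
    then show ?thesis
      using ij(2) s by (auto intro: O_cong_mult_left)
  qed
  have periods: "O_cong m (s ^ (k + q * d)) (s ^ k)" if "k \<ge> i" for k q
  proof (induction q)
    case (Suc q)
    have "O_cong m (s ^ ((k + q * d) + d)) (s ^ (k + q * d))"
      using that by (intro period) simp
    also note Suc
    finally show ?case
      by (simp add: algebra_simps)
  qed simp
  \<comment> \<open>A multiple of the period lying beyond the preperiod i; \<open>Suc i\<close>
    keeps it positive when i = 0.\<close>
  define N where "N = Suc i * d"
  have d: "d > 0"
    using ij(1) by (simp add: d_def)
  then have "i \<le> i * d"
    by simp
  then have "N \<ge> i"
    by (simp add: N_def trans_le_add2)
  then have "O_cong m (s ^ (N + Suc i * d)) (s ^ N)"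
    by (rule periods)
  then have "O_cong m (s ^ N * s ^ N) (s ^ N)"
    by (simp only: N_def[symmetric] power_add)
  moreover have "N > 0"
    using d by (simp add: N_def)
  ultimately show thesis
    using that by blast
qed

text \<open>A proper ideal of a finite ring has a nonzero annihilator: multiplying the complements of
  the idempotent powers of its elements gives a nonzero \<open>b\<close> on which all of them are nilpotent.\<close>

lemma proper_ideal_annihilator:
  fixes a :: "'k::field_char_0"
  assumes fr: "finite_residues a"
    and D: "D \<subseteq> \<O>" "\<And>x y. x \<in> D \<Longrightarrow> y \<in> D \<Longrightarrow> x + y \<in> D" "\<And>r x. r \<in> \<O> \<Longrightarrow> x \<in> D \<Longrightarrow> r * x \<in> D"
    and "a \<in> D" and "1 \<notin> D"
  obtains c where "c \<in> \<O>" "\<not> O_cong a c 0" "\<And>d. d \<in> D \<Longrightarrow> O_cong a (c * d) 0"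
proof -
  have Ddiff: "x - y \<in> D" if "x \<in> D" "y \<in> D" for x y
    using D(2)[OF that(1) D(3)[of "-1" y]] that by simp
  obtain F where F: "finite F" "F \<subseteq> \<O>" "\<forall>x\<in>\<O>. \<exists>f\<in>F. \<exists>y\<in>\<O>. x = f + a * y"
    using fr unfolding finite_residues_def by blast
  have nilpotent: "\<exists>b\<in>\<O>. b - 1 \<in> D \<and> (\<forall>d\<in>G. \<exists>N. O_cong a (b * d ^ N) 0)" if "finite G" "G \<subseteq> D" for G
    using that
  proof induction
    case empty
    show ?case
      \<comment> \<open>With b = 1 the claim is that 0 lies in D, obtained as 0 times a.\<close>
      using D(3)[of 0 a] \<open>a \<in> D\<close> by (intro bexI[of _ 1]) auto
  next
    case (insert d G)
    then obtain b where b: "b \<in> \<O>" "b - 1 \<in> D" "\<forall>d\<in>G. \<exists>N. O_cong a (b * d ^ N) 0"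
      by auto
    have d: "d \<in> D" "d \<in> \<O>"
      using insert.prems D(1) by auto
    obtain N where N: "N > 0" "O_cong a (d ^ N * d ^ N) (d ^ N)"
      using idempotent_power[OF fr d(2)] .
    \<comment> \<open>Multiplication by the complementary idempotent kills d^N while keeping b
      congruent to 1 modulo D.\<close>
    define b' where "b' = b * (1 - d ^ N)"
    have "d ^ N = d ^ (N - 1) * d"
      using N(1) by (metis power_minus_mult)
    then have "b * d ^ N \<in> D"
      using d b(1) D(3)[of "b * d ^ (N - 1)" d] by (simp add: mult.assoc)
    then have "(b - 1) - b * d ^ N \<in> D"
      by (rule Ddiff[OF b(2)])
    also have "(b - 1) - b * d ^ N = b' - 1"
      by (simp add: b'_def algebra_simps)
    finally have "b' - 1 \<in> D" .
    moreover have "\<exists>M. O_cong a (b' * f ^ M) 0" if f: "f \<in> insert d G" for f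
    proof (cases "f = d")
      case True
      have "b' * d ^ N = - b * (d ^ N * d ^ N - d ^ N)"
        by (simp add: b'_def algebra_simps)
      moreover have "O_cong a (- b * (d ^ N * d ^ N - d ^ N)) (- b * 0)"
        using N(2) b(1) by (intro O_cong_mult_left) (auto simp flip: O_cong_eq_diff)
      ultimately have "O_cong a (b' * d ^ N) 0"
        by simp
      then show ?thesis
        using True by blast
    next
      case False
      then obtain M where "O_cong a (b * f ^ M) 0"
        using f b(3) by auto
      then have "O_cong a ((1 - d ^ N) * (b * f ^ M)) ((1 - d ^ N) * 0)"
        using d by (intro O_cong_mult_left) auto
      then show ?thesis
        by (auto simp: b'_def mult_ac)
    qed
    moreover have "b' \<in> \<O>"
      using b(1) d by (simp add: b'_def)
    ultimately show ?case
      by blast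
  qed
  \<comment> \<open>Nilpotence is turned into annihilation one element at a time. Recording c as a
    multiple of b lets the nilpotence of the remaining elements carry over to c.\<close>
  have annihilator: "\<exists>c\<in>\<O>. \<not> O_cong a c 0 \<and> (\<exists>r\<in>\<O>. c = b * r) \<and> (\<forall>d\<in>G. O_cong a (c * d) 0)"
    if "finite G" "G \<subseteq> D" "\<forall>d\<in>G. \<exists>N. O_cong a (b * d ^ N) 0" "b \<in> \<O>" "\<not> O_cong a b 0" for b G
    using that
  proof induction
    case empty
    then show ?case
      by (intro bexI[of _ b]) (auto intro!: bexI[of _ 1])
  next
    case (insert d G)
    then obtain c r where c: "c \<in> \<O>" "\<not> O_cong a c 0" "r \<in> \<O>" "c = b * r" "\<forall>d\<in>G. O_cong a (c * d) 0"
      by auto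
    have d: "d \<in> \<O>"
      using insert.prems D(1) by auto
    obtain M where "O_cong a (b * d ^ M) 0"
      using insert.prems by auto
    then have "O_cong a (r * (b * d ^ M)) (r * 0)"
      using c(3) by (rule O_cong_mult_left)
    then have ex: "\<exists>M. O_cong a (c * d ^ M) 0"
      by (auto simp: c(4) mult_ac)
    \<comment> \<open>The last nonzero multiple c d^(M'-1) is killed by d; M' is positive because c
      itself is nonzero modulo a.\<close>
    define M' where "M' = (LEAST M. O_cong a (c * d ^ M) 0)"
    have M': "O_cong a (c * d ^ M') 0"
      unfolding M'_def using ex by (rule LeastI_ex)
    then obtain k where k: "M' = Suc k"
      using c(2) by (cases M') auto
    define c' where "c' = c * d ^ k"
    have "\<not> O_cong a c' 0"
      unfolding c'_def using not_less_Least[of k "\<lambda>M. O_cong a (c * d ^ M) 0"] k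
      by (simp add: M'_def)
    moreover have "O_cong a (c' * d) 0"
      using M' by (simp add: k c'_def mult_ac)
    moreover have "O_cong a (c' * f) 0" if "f \<in> G" for f
      using O_cong_mult_left[of a "c * f" 0 "d ^ k"] that c(5) d by (simp add: c'_def mult_ac)
    moreover have "c' = b * (r * d ^ k)" "r * d ^ k \<in> \<O>" "c' \<in> \<O>"
      using c d by (simp_all add: c'_def)
    ultimately show ?case
      by blast
  qed
  have FD: "finite (F \<inter> D)" "F \<inter> D \<subseteq> D"
    using F(1) by auto
  obtain b where b: "b \<in> \<O>" "b - 1 \<in> D" "\<forall>d\<in>F \<inter> D. \<exists>N. O_cong a (b * d ^ N) 0"
    using nilpotent[OF FD] by blast
  have "\<not> O_cong a b 0"
  proof
    assume "O_cong a b 0"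
    then obtain t where "t \<in> \<O>" "b = t * a"
      by (auto simp: O_cong_def mult.commute)
    then have "b \<in> D"
      using D(3) \<open>a \<in> D\<close> by simp
    from Ddiff[OF this b(2)] show False
      using \<open>1 \<notin> D\<close> by simp
  qed
  then obtain c where c: "c \<in> \<O>" "\<not> O_cong a c 0" "\<forall>d\<in>F \<inter> D. O_cong a (c * d) 0"
    using annihilator[OF FD b(3,1)] by blast
  \<comment> \<open>Only the representatives lying in D were treated; since a is in D, every d in D
    differs from one of these by a multiple of a.\<close>
  have "O_cong a (c * d) 0" if d: "d \<in> D" for d
  proof -
    obtain f y where f: "f \<in> F" "y \<in> \<O>" "d = f + y * a"
      using F(3) D(1) d by (metis mult.commute subsetD)
    then have "f = d - y * a"
      by simp
    then have "f \<in> D"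
      using Ddiff[OF d D(3)[OF f(2) \<open>a \<in> D\<close>]] by simp
    then have "O_cong a (c * f + (c * y) * a) (0 + (c * y) * 0)"
      using c f by (intro O_cong_add O_cong_mult_left) auto
    then show ?thesis
      using f(3) by (simp add: algebra_simps)
  qed
  then show thesis
    using that c by blast
qed

section \<open>The inverse of a fractional ideal\<close>

definition colon :: "'k::field_char_0 set \<Rightarrow> 'k set"
  where "colon I = {x. \<forall>y\<in>I. x * y \<in> \<O>}"

text \<open>The product ideal, built inductively rather than as the indexed sums of
  \<open>ideal_mult\<close>, to allow induction over the summands.\<close>

inductive_set product_sums :: "'k::field_char_0 set \<Rightarrow> 'k set \<Rightarrow> 'k set" for I J
  where zero: "0 \<in> product_sums I J"
  | step: "a \<in> I \<Longrightarrow> b \<in> J \<Longrightarrow> x \<in> product_sums I J \<Longrightarrow> a * b + x \<in> product_sums I J"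

lemma product_sums_add:
  "x \<in> product_sums I J \<Longrightarrow> y \<in> product_sums I J \<Longrightarrow> x + y \<in> product_sums I J"
  by (induction rule: product_sums.induct) (auto simp: add.assoc intro: product_sums.step)

lemma product_sums_mult:
  assumes "\<And>y. y \<in> I \<Longrightarrow> r * y \<in> I"
  shows "x \<in> product_sums I J \<Longrightarrow> r * x \<in> product_sums I J"
  by (induction rule: product_sums.induct)
    (auto simp: distrib_left mult.assoc[symmetric] intro: product_sums.intros assms)

lemma product_sums_colon_subset: "product_sums I (colon I) \<subseteq> \<O>"
proof
  show "x \<in> \<O>" if "x \<in> product_sums I (colon I)" for x
    using that by induction (auto simp: colon_def mult.commute)
qed

lemma colon_add: "x \<in> colon I \<Longrightarrow> y \<in> colon I \<Longrightarrow> x + y \<in> colon I"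
  and colon_mult: "r \<in> \<O> \<Longrightarrow> x \<in> colon I \<Longrightarrow> r * x \<in> colon I"
  by (auto simp: colon_def distrib_right mult.assoc)

lemma fractional_idealD:
  assumes "fractional_ideal I"
  shows "0 \<in> I" "x \<in> I \<Longrightarrow> y \<in> I \<Longrightarrow> x + y \<in> I" "r \<in> \<O> \<Longrightarrow> x \<in> I \<Longrightarrow> r * x \<in> I"
  using assms by (auto simp: fractional_ideal_def)

lemma nonzero_fractional_ideal:
  assumes "fractional_ideal I" and "I \<noteq> {0}"
  obtains a b where "a \<in> I" "a \<noteq> 0" "b \<in> colon I" "b \<noteq> 0"
proof -
  obtain a where "a \<in> I" "a \<noteq> 0"
    using fractional_idealD(1)[OF assms(1)] assms(2) by blast
  moreover obtain d where "d \<noteq> 0" "\<forall>x\<in>I. d * x \<in> \<O>"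
    using assms(1) unfolding fractional_ideal_def by blast
  ultimately show thesis
    using that[of a d] by (simp add: colon_def)
qed

text \<open>If D = I (\<open>\<O>\<close> : I) were proper, an annihilator c of D modulo m would
  give x = c/m with x D inside \<open>\<O>\<close>. Then x maps (\<open>\<O>\<close> : I) to itself,
  so all m x^k are integral and x is integral; but this says that c is 0 modulo m.\<close>

lemma fractional_ideal_invertible:
  fixes I :: "'k::field_char_0 set"
  assumes K: "number_field TYPE('k)" and I: "fractional_ideal I" "I \<noteq> {0}"
  shows "1 \<in> product_sums I (colon I)"
proof (rule ccontr)
  let ?D = "product_sums I (colon I)"
  assume "1 \<notin> ?D"
  obtain a b where ab: "a \<in> I" "a \<noteq> 0" "b \<in> colon I" "b \<noteq> 0"
    using nonzero_fractional_ideal[OF I] .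
  define m where "m = a * b"
  have prod: "y * z \<in> ?D" if "y \<in> I" "z \<in> colon I" for y z
    using product_sums.step[OF that product_sums.zero] by simp
  have m: "m \<noteq> 0" "m \<in> ?D"
    using ab prod by (auto simp: m_def)
  obtain c where c: "c \<in> \<O>" "\<not> O_cong m c 0" "\<And>d. d \<in> ?D \<Longrightarrow> O_cong m (c * d) 0"
    using proper_ideal_annihilator[OF finite_residues[OF K m(1)] product_sums_colon_subset
        product_sums_add product_sums_mult m(2) \<open>1 \<notin> ?D\<close>] fractional_idealD(3)[OF I(1)] by blast
  define x where "x = c / m"
  have xD: "x * d \<in> \<O>" if "d \<in> ?D" for d
    using c(3)[OF that] m(1) by (auto simp: O_cong_def x_def)
  have "x * y \<in> colon I" if "y \<in> colon I" for y
    using xD[OF prod[OF _ that]] by (auto simp: colon_def mult_ac)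
  then have "x ^ k * b \<in> colon I" for k
    by (induction k) (auto simp: ab mult.assoc)
  then have "m * x ^ k \<in> \<O>" for k
    using ab(1) by (auto simp: colon_def m_def mult_ac)
  then have "x \<in> \<O>"
    by (rule completely_integrally_closed[OF K m(1)])
  then have "O_cong m c 0"
    using m(1) by (auto simp: O_cong_def x_def intro!: bexI[of _ x])
  then show False
    using c(2) by simp
qed

text \<open>Given a sum \<open>a b + x\<close> that is 1 on the idempotent \<open>f\<close>, let \<open>e\<close> be an idempotent power of \<open>a b\<close>.
  On \<open>f e\<close> the single product is invertible; on \<open>f (1 - e)\<close> it is nilpotent, so \<open>x\<close> is invertible there.
  The factors found on the two orthogonal pieces are glued.\<close>

lemma idempotent_is_product:
  assumes fr: "finite_residues m" and I: "fractional_ideal I"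
  shows "x \<in> product_sums I (colon I) \<Longrightarrow> w \<in> \<O> \<Longrightarrow> f \<in> \<O> \<Longrightarrow> O_cong m (f * f) f \<Longrightarrow>
    O_cong m (w * x * f) f \<Longrightarrow> \<exists>v\<in>I. \<exists>u\<in>colon I. O_cong m (v * u) f"
proof (induction arbitrary: w f rule: product_sums.induct)
  case zero
  \<comment> \<open>For the empty sum the premise forces f to be 0 modulo m, so v = u = 0
    works.\<close>
  have "0 \<in> colon I"
    by (simp add: colon_def)
  moreover have "O_cong m (0 * 0) f"
    using zero(4) by simp
  ultimately show ?case
    using fractional_idealD(1)[OF I] by blast
next
  case (step a b x)
  have ab: "a * b \<in> \<O>"
    using step(1,2) by (auto simp: colon_def mult.commute)
  have xO: "x \<in> \<O>"
    using step(3) product_sums_colon_subset by blast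
  \<comment> \<open>On f the premise reads s + w x = 1.\<close>
  define s where "s = w * (a * b)"
  have s: "s \<in> \<O>"
    using step(5) ab by (simp add: s_def)
  obtain N where N: "N > 0" "O_cong m (s ^ N * s ^ N) (s ^ N)"
    using idempotent_power[OF fr s] .
  define e where "e = s ^ N"
  \<comment> \<open>A geometric sum: W inverts 1 - s away from e.\<close>
  define W where "W = (\<Sum>j<N. s ^ j)"
  define f' where "f' = f * (1 - e)"
  have eO: "e \<in> \<O>" and WO: "W \<in> \<O>" and f'O: "f' \<in> \<O>"
    using s step(6) by (auto simp: e_def W_def f'_def intro!: O_sum O_mult O_diff)
  have ee: "O_cong m (e * e) e"
    using N(2) by (simp add: e_def)
  have W: "(1 - s) * W = 1 - e"
    by (simp add: e_def W_def one_diff_power_eq)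
  have "O_cong m ((1 - e) * (1 - e) - (1 - e)) 0"
    using ee by (simp add: algebra_simps flip: O_cong_eq_diff)
  then have ee': "O_cong m ((1 - e) * (1 - e)) (1 - e)"
    by (simp flip: O_cong_eq_diff)
  have "f' * f' = (f * f) * ((1 - e) * (1 - e))"
    by (simp add: f'_def mult_ac)
  also have "O_cong m \<dots> f'"
    unfolding f'_def using step(6,7) ee' eO by (intro O_cong_mult) auto
  finally have f'f': "O_cong m (f' * f') f'" .
  have "O_cong m ((e - e * e) * f) (0 * f)"
    using ee step(6) by (intro O_cong_mult_right) (auto simp: O_cong_sym simp flip: O_cong_eq_diff)
  then have f'e: "O_cong m (f' * e) 0"
    by (simp add: f'_def algebra_simps)
  have "O_cong m (w * (a * b + x) * f - s * f) (f - s * f)"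
    using O_cong_add[OF step(8) O_cong_refl[of m "- (s * f)"]] by simp
  then have "O_cong m (w * x * f) (f * (1 - s))"
    by (simp add: s_def algebra_simps)
  then have "O_cong m (W * (1 - e) * (w * x * f)) (W * (1 - e) * (f * (1 - s)))"
    using WO eO by (intro O_cong_mult_left) auto
  also have "W * (1 - e) * (f * (1 - s)) = f * ((1 - e) * (1 - e))"
    by (simp only: W[symmetric] mult_ac)
  also have "O_cong m \<dots> f'"
    unfolding f'_def using ee' step(6) by (intro O_cong_mult_left)
  finally have cong: "O_cong m (w * W * x * f') f'"
    by (simp add: f'_def mult_ac)
  \<comment> \<open>On f' the multiplier w W inverts x, since there w x is 1 - s.\<close>
  obtain v u where vu: "v \<in> I" "u \<in> colon I" "O_cong m (v * u) f'"
    using step.IH[OF O_mult[OF step(5) WO] f'O f'f' cong] by blast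
  \<comment> \<open>One factor s = w a b of s^N is stripped of a, so that a u' is exactly e.\<close>
  define u' where "u' = s ^ (N - 1) * w * b"
  have u': "u' \<in> colon I"
    unfolding u'_def using s step(2,5) by (intro colon_mult) auto
  have "a * u' = s ^ (N - 1) * s"
    by (simp add: u'_def s_def mult_ac)
  then have au': "a * u' = e"
    using power_minus_mult[OF N(1)] by (simp add: e_def)
  have cross: "v * u' + a * u \<in> \<O>"
    using vu(1,2) step(1) u' by (auto simp: colon_def mult.commute)
  have vuO: "v * u \<in> \<O>"
    using vu(1,2) by (auto simp: colon_def mult.commute)
  have "O_cong m (f' * f' * (v * u)) (f' * f')"
    using O_cong_mult[OF f'f' vu(3)] f'O by auto
  also note f'f'
  finally have 1: "O_cong m (f' * f' * (v * u)) f'" .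
  have "O_cong m (f' * e * (f * (v * u' + a * u))) (0 * (f * (v * u' + a * u)))"
    using f'e cross step(6) by (intro O_cong_mult_right) auto
  then have 2: "O_cong m (f' * e * (f * (v * u' + a * u))) 0"
    by simp
  have "O_cong m (e * e * e) (e * e)"
    using ee eO by (intro O_cong_mult_right)
  also note ee
  finally have 3: "O_cong m (f * f * (e * e * e)) (f * e)"
    using step(6,7) eO by (intro O_cong_mult) auto
  \<comment> \<open>Gluing works because the cross terms carry the factor f' e, which vanishes
    modulo m.\<close>
  have "(f' * v + (f * e) * a) * (f' * u + (f * e) * u') =
      f' * f' * (v * u) + f' * e * (f * (v * u' + a * u)) + f * f * (e * e * (a * u'))"
    by (simp add: algebra_simps)
  also have "O_cong m \<dots> (f' + 0 + f * e)"
    unfolding au' using 1 2 3 by (intro O_cong_add)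
  also have "f' + 0 + f * e = f"
    by (simp add: f'_def algebra_simps)
  finally have "O_cong m ((f' * v + (f * e) * a) * (f' * u + (f * e) * u')) f" .
  moreover have "f' * v + (f * e) * a \<in> I"
    using fractional_idealD(2,3)[OF I] f'O vu(1) step(1,6) eO by auto
  moreover have "f' * u + (f * e) * u' \<in> colon I"
    using f'O vu(2) u' step(6) eO by (intro colon_add colon_mult) auto
  ultimately show ?case
    by blast
qed

text \<open>Modulo a b, with nonzero a in I and b in (\<open>\<O>\<close> : I), the element 1 is a
  single product v u. The error a b t is itself a product of a with t b, which supplies the second
  pair.\<close>

lemma fractional_ideal_two_generators:
  fixes I :: "'k::field_char_0 set"
  assumes K: "number_field TYPE('k)" and I: "fractional_ideal I" "I \<noteq> {0}"
  obtains v1 v2 u1 u2 where "v1 \<in> I" "v2 \<in> I" "u1 \<in> colon I" "u2 \<in> colon I" "u1 * v1 + u2 * v2 = 1"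
proof -
  obtain a b where ab: "a \<in> I" "a \<noteq> 0" "b \<in> colon I" "b \<noteq> 0"
    using nonzero_fractional_ideal[OF I] .
  have "finite_residues (a * b)"
    using finite_residues[OF K] ab by simp
  then obtain v u where vu: "v \<in> I" "u \<in> colon I" "O_cong (a * b) (v * u) 1"
    using idempotent_is_product[OF _ I(1) fractional_ideal_invertible[OF K I], of "a * b" 1 1] by auto
  then obtain t where t: "t \<in> \<O>" "v * u = 1 + a * b * t"
    by (auto simp: O_cong_def)
  have "(- t) * b \<in> colon I"
    using t(1) ab(3) by (intro colon_mult) auto
  moreover have "u * v + ((- t) * b) * a = 1"
    using t(2) by (simp add: algebra_simps)
  ultimately show thesis
    using that vu(1,2) ab(1) by blast
qed

section \<open>Roots of unity and characters\<close>

lemma coprime_factorization_if_not_primepow: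
  fixes n :: nat
  assumes "n > 1" and "\<not> primepow n"
  obtains a b where "n = a * b" "coprime a b" "a > 1" "b > 1"
proof -
  obtain p where p: "prime p" "p dvd n"
    using prime_factor_nat[of n] assms(1) by auto
  define k where "k = multiplicity p n"
  have k: "k > 0"
    using p assms(1) by (simp add: k_def prime_multiplicity_gt_zero_iff)
  obtain b where b: "n = p ^ k * b" "\<not> p dvd b"
    unfolding k_def using multiplicity_decompose'[of n p] p(1) assms(1)
    by (metis not_less_zero not_prime_unit)
  have "b \<noteq> 0"
    using b(1) assms(1) by (intro notI) simp
  moreover have "b \<noteq> 1"
    using assms(2) b(1) p(1) k unfolding primepow_def by (metis mult.right_neutral)
  moreover have "p ^ k > 1"
    using k prime_gt_1_nat[OF p(1)] by (metis one_less_power)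
  moreover have "coprime (p ^ k) b"
    using p(1) b(2) by (simp add: prime_imp_coprime)
  ultimately show thesis
    using that[of "p ^ k" b] b(1) by simp
qed

text \<open>For n = a b with b > 1, z^a is a nontrivial b-th root of unity, so its powers sum to 0
  and b is the sum of the terms 1 - z^(a i), all divisible by 1 - z. A coprime factorization makes 1
  - z divide both factors, hence 1.\<close>

lemma one_minus_root_of_unity_is_unit:
  fixes z :: "'k::field_char_0"
  assumes z: "z ^ n = 1" "\<And>k. 0 < k \<Longrightarrow> k < n \<Longrightarrow> z ^ k \<noteq> 1"
    and n: "n > 1" "\<not> primepow n"
  shows "inverse (1 - z) \<in> \<O>"
proof -
  define r where "r = inverse (1 - z)"
  have zO: "z \<in> \<O>"
    using z(1) n(1) by (intro O_if_power_diff[of z n 0]) auto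
  have "z \<noteq> 1"
    using z(2)[of 1] n(1) by simp
  then have r: "r * (1 - z) = 1"
    by (simp add: r_def)
  have quotient: "r * (1 - z ^ k) \<in> \<O>" for k
  proof -
    have "r * (1 - z ^ k) = (\<Sum>i<k. z ^ i)"
      using r by (simp add: one_diff_power_eq mult.assoc[symmetric])
    then show ?thesis
      using zO by (auto intro: O_sum)
  qed
  have multiple: "r * of_nat b \<in> \<O>" if ab: "n = a * b" "a > 0" "b > 1" for a b
  proof -
    have "a < n"
      using ab by simp
    then have "z ^ a \<noteq> 1"
      using z(2) ab(2) by blast
    moreover have "(1 - z ^ a) * (\<Sum>i<b. (z ^ a) ^ i) = 0"
      unfolding one_diff_power_eq[symmetric] using z(1) by (simp add: ab(1) power_mult)
    ultimately have "(\<Sum>i<b. (z ^ a) ^ i) = 0"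
      by simp
    then have "of_nat b = (\<Sum>i<b. 1 - (z ^ a) ^ i)"
      by (simp add: sum_subtractf)
    then have "r * of_nat b = (\<Sum>i<b. r * (1 - z ^ (a * i)))"
      by (simp only: sum_distrib_left power_mult)
    also have "\<dots> \<in> \<O>"
      by (intro O_sum quotient)
    finally show ?thesis .
  qed
  obtain a b where ab: "n = a * b" "coprime a b" "a > 1" "b > 1"
    using coprime_factorization_if_not_primepow[OF n] .
  obtain x y where xy: "x * int a + y * int b = 1"
    using bezout_int[of "int a" "int b"] ab(2) by auto
  have one: "of_int x * of_nat a + of_int y * of_nat b = (1::'k)"
    using arg_cong[OF xy, of "of_int :: int \<Rightarrow> 'k"] by simp
  have "r = r * (of_int x * of_nat a + of_int y * of_nat b)"
    by (simp only: one mult_1_right)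
  also have "\<dots> = of_int x * (r * of_nat a) + of_int y * (r * of_nat b)"
    by (simp add: algebra_simps)
  also have "\<dots> \<in> \<O>"
    using multiple[of a b] multiple[of b a] ab by (simp add: mult.commute)
  finally show ?thesis
    by (simp add: r_def)
qed

lemma group_unit_group: "group unit_group"
proof (rule groupI)
  fix x :: 'a assume "x \<in> carrier unit_group"
  then show "\<exists>y\<in>carrier unit_group. y \<otimes>\<^bsub>unit_group\<^esub> x = \<one>\<^bsub>unit_group\<^esub>"
    by (intro bexI[of _ "inverse x"]) (auto simp: unit_group_def)
qed (auto simp: unit_group_def)

lemma in_homs_unit_group:
  "chi \<in> homs C unit_group \<longleftrightarrow> chi \<in> extensional (carrier C) \<and> (\<forall>g\<in>carrier C. chi g \<noteq> 0) \<and>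
    (\<forall>g\<in>carrier C. \<forall>h\<in>carrier C. chi (g \<otimes>\<^bsub>C\<^esub> h) = chi g * chi h)"
  by (auto simp: homs_def hom_def unit_group_def)

lemma group_character_group:
  assumes "group C"
  shows "group (character_group C)"
proof -
  interpret group C by fact
  show ?thesis
  proof (rule groupI)
    fix x y z :: "'a \<Rightarrow> 'c"
    assume *: "x \<in> carrier (character_group C)" "y \<in> carrier (character_group C)" "z \<in> carrier (character_group C)"
    show "x \<otimes>\<^bsub>character_group C\<^esub> y \<in> carrier (character_group C)"
      using * by (simp add: character_group_def in_homs_unit_group)
    show "x \<otimes>\<^bsub>character_group C\<^esub> y \<otimes>\<^bsub>character_group C\<^esub> z =
        x \<otimes>\<^bsub>character_group C\<^esub> (y \<otimes>\<^bsub>character_group C\<^esub> z)"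
      by (auto simp: character_group_def restrict_def mult.assoc)
  next
    fix x :: "'a \<Rightarrow> 'c" assume *: "x \<in> carrier (character_group C)"
    show "\<one>\<^bsub>character_group C\<^esub> \<otimes>\<^bsub>character_group C\<^esub> x = x"
      using * by (auto simp: character_group_def in_homs_unit_group extensional_def restrict_def)
    have "(\<lambda>g\<in>carrier C. inverse (x g)) \<in> carrier (character_group C)"
      using * by (simp add: character_group_def in_homs_unit_group)
    moreover have "(\<lambda>g\<in>carrier C. inverse (x g)) \<otimes>\<^bsub>character_group C\<^esub> x = \<one>\<^bsub>character_group C\<^esub>"
      using * by (auto simp: character_group_def in_homs_unit_group restrict_def)
    ultimately show "\<exists>y\<in>carrier (character_group C). y \<otimes>\<^bsub>character_group C\<^esub> x = \<one>\<^bsub>character_group C\<^esub>"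
      by blast
  qed (simp add: character_group_def in_homs_unit_group)
qed

lemma character_group_pow:
  "chi [^]\<^bsub>character_group C\<^esub> (k::nat) = (\<lambda>g\<in>carrier C. chi g ^ k)"
  by (induction k) (auto simp: character_group_def restrict_def mult.commute)

lemma unit_group_pow: "x [^]\<^bsub>unit_group\<^esub> (k::nat) = x ^ k"
  by (induction k) (auto simp: unit_group_def mult.commute)

text \<open>A character of a cyclic group is determined by its value at a generator, so its order is
  the multiplicative order of that value.\<close>

lemma character_generator_order:
  fixes chi :: "'c \<Rightarrow> 'k::field_char_0"
  assumes "group C" and "cyclic_group C" and chi: "chi \<in> carrier (character_group C)"
    and n: "n = group.ord (character_group C) chi"
  obtains g0 where "g0 \<in> carrier C" "\<And>k. chi g0 ^ k = 1 \<longleftrightarrow> n dvd k"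
proof -
  interpret C: group C by fact
  interpret X: group "character_group C :: ('c \<Rightarrow> 'k) monoid"
    using assms(1) by (rule group_character_group)
  interpret chi: group_hom C unit_group chi
    using chi assms(1) group_unit_group
    by (simp add: group_hom_def group_hom_axioms_def character_group_def homs_def)
  obtain g0 where g0: "g0 \<in> carrier C" "carrier C = range (\<lambda>i::int. g0 [^]\<^bsub>C\<^esub> i)"
    using assms(2) C.cyclic_group by blast
  have "chi g0 ^ k = 1 \<longleftrightarrow> n dvd k" for k
  proof -
    have "chi g ^ k = 1" if k: "chi g0 ^ k = 1" and g: "g \<in> carrier C" for g
    proof -
      obtain i :: int where i: "g = g0 [^]\<^bsub>C\<^esub> i"
        using g g0(2) by auto
      have "chi g ^ k = chi (g [^]\<^bsub>C\<^esub> k)"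
        using chi.hom_nat_pow[OF g] by (simp add: unit_group_pow)
      also have "g [^]\<^bsub>C\<^esub> k = (g0 [^]\<^bsub>C\<^esub> k) [^]\<^bsub>C\<^esub> i"
        using g0(1) by (simp add: i C.int_pow_pow mult.commute flip: int_pow_int)
      also have "chi \<dots> = chi (g0 [^]\<^bsub>C\<^esub> k) [^]\<^bsub>unit_group\<^esub> i"
        using g0(1) by (simp add: chi.hom_int_pow)
      also have "chi (g0 [^]\<^bsub>C\<^esub> k) = \<one>\<^bsub>unit_group\<^esub>"
        using k chi.hom_nat_pow[OF g0(1)] by (simp add: unit_group_pow) (simp add: unit_group_def)
      finally show ?thesis
        by (simp add: group.int_pow_one[OF group_unit_group]) (simp add: unit_group_def)
    qed
    then have "chi g0 ^ k = 1 \<longleftrightarrow> (\<forall>g\<in>carrier C. chi g ^ k = 1)"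
      using g0(1) by blast
    also have "\<dots> \<longleftrightarrow> chi [^]\<^bsub>character_group C\<^esub> k = \<one>\<^bsub>character_group C\<^esub>"
      unfolding character_group_pow by (auto simp: character_group_def restrict_def fun_eq_iff)
    also have "\<dots> \<longleftrightarrow> n dvd k"
      unfolding n using chi by (rule X.pow_eq_id)
    finally show ?thesis .
  qed
  then show thesis
    using that g0(1) by blast
qed

section \<open>Integral splittings of the plane\<close>

no_notation vec_index (infixl "$" 100)
hide_const (open) Matrix.mat
hide_fact (open) Matrix.mat_def

text \<open>R is an arbitrary set, for which \<open>GL R\<close> may fail to be a group; uniqueness
  of matrix inverses identifies \<open>inv\<close> directly.\<close>

lemma GL_inv:
  assumes "A \<in> carrier (GL R)" and B: "\<And>i j. B $ i $ j \<in> R" "A ** B = mat 1" "B ** A = mat 1"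
  shows "inv\<^bsub>GL R\<^esub> A = B"
  unfolding m_inv_def
proof (rule the_equality)
  have "B \<in> carrier (GL R)"
    using assms by (auto simp: GL_def)
  then show "B \<in> carrier (GL R) \<and> A \<otimes>\<^bsub>GL R\<^esub> B = \<one>\<^bsub>GL R\<^esub> \<and> B \<otimes>\<^bsub>GL R\<^esub> A = \<one>\<^bsub>GL R\<^esub>"
    using B by (simp add: GL_def)
  fix D assume "D \<in> carrier (GL R) \<and> A \<otimes>\<^bsub>GL R\<^esub> D = \<one>\<^bsub>GL R\<^esub> \<and> D \<otimes>\<^bsub>GL R\<^esub> A = \<one>\<^bsub>GL R\<^esub>"
  then have "D ** A = mat 1"
    by (simp add: GL_def)
  then show "D = B"
    by (metis B(2) matrix_mul_assoc matrix_mul_lid matrix_mul_rid)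
qed

lemma conjugate_in_GL:
  "conjugate_in (GL R) C \<phi> \<psi> \<longleftrightarrow> (\<exists>P\<in>carrier (GL R). \<forall>g\<in>carrier C. \<psi> g ** P = P ** \<phi> g)"
proof -
  have "\<psi> g = P \<otimes>\<^bsub>GL R\<^esub> \<phi> g \<otimes>\<^bsub>GL R\<^esub> inv\<^bsub>GL R\<^esub> P \<longleftrightarrow> \<psi> g ** P = P ** \<phi> g"
    if P: "P \<in> carrier (GL R)" for P g
  proof -
    obtain B where B: "\<And>i j. B $ i $ j \<in> R" "P ** B = mat 1" "B ** P = mat 1"
      using P by (auto simp: GL_def)
    have "\<psi> g = P ** \<phi> g ** B \<longleftrightarrow> \<psi> g ** P = P ** \<phi> g"
      by (metis B(2,3) matrix_mul_assoc matrix_mul_rid)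
    then show ?thesis
      using GL_inv[OF P B] by (simp add: GL_def)
  qed
  then show ?thesis
    unfolding conjugate_in_def by blast
qed

text \<open>The matrix acting as 1 on \<open>u\<close> and as the scalar \<open>z\<close> on the kernel of the linear form \<open>v\<close>,
  provided that \<open>v\<close> takes the value 1 at \<open>u\<close>.\<close>

definition split_matrix :: "'k::field_char_0^2 \<Rightarrow> 'k^2 \<Rightarrow> 'k \<Rightarrow> 'k^2^2"
  where "split_matrix u v z = (\<chi> i j. u $ i * v $ j + z * ((if i = j then 1 else 0) - u $ i * v $ j))"

text \<open>Integrality is asked of the projection only: u and v may have denominators, as v has to
  generate an arbitrary fractional ideal.\<close>

definition integral_splitting :: "'k::field_char_0^2 \<Rightarrow> 'k^2 \<Rightarrow> bool"
  where "integral_splitting u v \<longleftrightarrow> u $ 1 * v $ 1 + u $ 2 * v $ 2 = 1 \<and> (\<forall>i j. u $ i * v $ j \<in> \<O>)"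

definition entries_ideal :: "'k::field_char_0^2 \<Rightarrow> 'k set"
  where "entries_ideal v = {x * v $ 1 + y * v $ 2 | x y. x \<in> \<O> \<and> y \<in> \<O>}"

lemmas matrix2_simps = matrix_matrix_mult_def Finite_Cartesian_Product.vec_eq_iff forall_2 sum_2 mat_def

lemma split_matrix_1: "split_matrix u v 1 = mat 1"
  by (simp add: split_matrix_def mat_def)

text \<open>The matrix is e + z (1 - e) with e idempotent, hence multiplicative in z.\<close>

lemma split_matrix_mult:
  assumes "u $ 1 * v $ 1 + u $ 2 * v $ 2 = 1"
  shows "split_matrix u v a ** split_matrix u v b = split_matrix u v (a * b)"
  unfolding matrix2_simps split_matrix_def by (simp, (intro conjI; insert assms; Groebner_Basis.algebra))

lemma split_matrix_in_O:
  assumes "integral_splitting u v" and "z \<in> \<O>"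
  shows "split_matrix u v z $ i $ j \<in> \<O>"
  using assms by (simp add: split_matrix_def integral_splitting_def)

lemma split_matrix_in_GL:
  assumes uv: "integral_splitting u v" and z: "z \<in> \<O>" "inverse z \<in> \<O>" "z \<noteq> 0"
  shows "split_matrix u v z \<in> carrier (GL \<O>)"
proof -
  have "split_matrix u v z ** split_matrix u v (inverse z) = mat 1"
    "split_matrix u v (inverse z) ** split_matrix u v z = mat 1"
    using uv z(3) by (simp_all add: integral_splitting_def split_matrix_mult split_matrix_1)
  then show ?thesis
    using split_matrix_in_O[OF uv z(1)] split_matrix_in_O[OF uv z(2)] by (auto simp: GL_def)
qed

text \<open>The matrix sending u to u' and (v_2, -v_1), which spans the kernel of v, to (v'_2,
  -v'_1). Its entries involve only products u'_i v_j and v'_i u_j.\<close>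

definition transition :: "'k::field_char_0^2 \<Rightarrow> 'k^2 \<Rightarrow> 'k^2 \<Rightarrow> 'k^2 \<Rightarrow> 'k^2^2"
  where "transition u v u' v' =
    vector [vector [u' $ 1 * v $ 1 + v' $ 2 * u $ 2, u' $ 1 * v $ 2 - v' $ 2 * u $ 1],
            vector [u' $ 2 * v $ 1 - v' $ 1 * u $ 2, u' $ 2 * v $ 2 + v' $ 1 * u $ 1]]"

lemma transition_inverse:
  assumes "u $ 1 * v $ 1 + u $ 2 * v $ 2 = 1" "u' $ 1 * v' $ 1 + u' $ 2 * v' $ 2 = 1"
  shows "transition u v u' v' ** transition u' v' u v = mat 1"
proof -
  \<comment> \<open>The diagonal entries of the product expand to exactly this expression.\<close>
  have "(u $ 1 * v $ 1 + u $ 2 * v $ 2) * (u' $ 1 * v' $ 1 + u' $ 2 * v' $ 2) = 1"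
    using assms by simp
  then show ?thesis
    unfolding matrix2_simps transition_def by (simp add: algebra_simps)
qed

lemma transition_intertwines:
  assumes "u $ 1 * v $ 1 + u $ 2 * v $ 2 = 1" "u' $ 1 * v' $ 1 + u' $ 2 * v' $ 2 = 1"
  shows "split_matrix u' v' z ** transition u v u' v' = transition u v u' v' ** split_matrix u v z"
  unfolding matrix2_simps transition_def split_matrix_def by (simp, (intro conjI; insert assms; Groebner_Basis.algebra))

text \<open>R is kept general to cover both \<open>\<O>\<close>, for integral conjugacy, and
  \<open>UNIV\<close>, for conjugacy over K.\<close>

lemma transition_in_GL:
  assumes uv: "u $ 1 * v $ 1 + u $ 2 * v $ 2 = 1" "u' $ 1 * v' $ 1 + u' $ 2 * v' $ 2 = 1"
    and O: "\<And>i j. u' $ i * v $ j \<in> R" "\<And>i j. v' $ i * u $ j \<in> R"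
    and R: "\<And>x y. x \<in> R \<Longrightarrow> y \<in> R \<Longrightarrow> x + y \<in> R" "\<And>x y. x \<in> R \<Longrightarrow> y \<in> R \<Longrightarrow> x - y \<in> R"
  shows "transition u v u' v' \<in> carrier (GL R)"
proof -
  have O': "u $ i * v' $ j \<in> R" "v $ i * u' $ j \<in> R" for i j
    using O[of j i] by (simp_all add: mult.commute)
  have "\<forall>i j. transition u v u' v' $ i $ j \<in> R" "\<forall>i j. transition u' v' u v $ i $ j \<in> R"
    by (simp_all add: transition_def forall_2 O O' R)
  then show ?thesis
    using transition_inverse[OF uv] transition_inverse[OF uv(2,1)] by (auto simp: GL_def)
qed

lemma one_plus_char_eq: "one_plus_char chi g = split_matrix (axis 1 1) (axis 1 1) (chi g)"
  by (simp add: one_plus_char_def split_matrix_def Finite_Cartesian_Product.vec_eq_iff forall_2 axis_def)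

lemma inverse_mult_cancel: "c \<noteq> 0 \<Longrightarrow> inverse c * x * (c * y) = x * (y :: 'a::field)"
  by (simp add: field_simps)

lemma split_matrix_scale: "c \<noteq> 0 \<Longrightarrow> split_matrix (inverse c *s u) (c *s v) z = split_matrix u v z"
  by (simp add: split_matrix_def inverse_mult_cancel)

lemma integral_splitting_scale:
  "integral_splitting u v \<Longrightarrow> c \<noteq> 0 \<Longrightarrow> integral_splitting (inverse c *s u) (c *s v)"
  by (simp add: integral_splitting_def inverse_mult_cancel)

lemma mem_entries_ideal:
  "x \<in> \<O> \<Longrightarrow> y \<in> \<O> \<Longrightarrow> x * v $ 1 + y * v $ 2 \<in> entries_ideal v"
  by (auto simp: entries_ideal_def)

lemma component_in_entries_ideal: "v $ i \<in> entries_ideal v"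
  using mem_entries_ideal[of 1 0 v] mem_entries_ideal[of 0 1 v] exhaust_2[of i] by auto

lemma integral_splitting_mult_entries_ideal:
  assumes "integral_splitting u v" and "x \<in> entries_ideal v"
  shows "u $ i * x \<in> \<O>"
proof -
  obtain a b where "a \<in> \<O>" "b \<in> \<O>" "x = a * v $ 1 + b * v $ 2"
    using assms(2) by (auto simp: entries_ideal_def)
  then have "u $ i * x = a * (u $ i * v $ 1) + b * (u $ i * v $ 2)"
    by (simp add: algebra_simps)
  then show ?thesis
    using \<open>a \<in> \<O>\<close> \<open>b \<in> \<O>\<close> assms(1) by (simp add: integral_splitting_def)
qed

lemma entries_ideal_scale: "entries_ideal (c *s v) = (\<lambda>x. c * x) ` entries_ideal v"
  by (force simp: entries_ideal_def image_iff algebra_simps)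

lemma fractional_entries_ideal:
  fixes u v :: "'k::field_char_0^2"
  assumes K: "number_field TYPE('k)" and uv: "integral_splitting u v"
  shows "fractional_ideal (entries_ideal v)" and "entries_ideal v \<noteq> {0}"
proof -
  have "0 \<in> entries_ideal v"
    using mem_entries_ideal[of 0 0 v] by simp
  moreover have "x + y \<in> entries_ideal v" if xy: "x \<in> entries_ideal v" "y \<in> entries_ideal v" for x y
  proof -
    obtain a b a' b' where *: "a \<in> \<O>" "b \<in> \<O>" "x = a * v $ 1 + b * v $ 2"
      "a' \<in> \<O>" "b' \<in> \<O>" "y = a' * v $ 1 + b' * v $ 2"
      using xy by (auto simp: entries_ideal_def)
    then have "x + y = (a + a') * v $ 1 + (b + b') * v $ 2"
      by (simp add: algebra_simps)
    then show ?thesis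
      using * mem_entries_ideal[of "a + a'" "b + b'" v] by simp
  qed
  moreover have "r * x \<in> entries_ideal v" if rx: "r \<in> \<O>" "x \<in> entries_ideal v" for r x
  proof -
    obtain a b where *: "a \<in> \<O>" "b \<in> \<O>" "x = a * v $ 1 + b * v $ 2"
      using rx by (auto simp: entries_ideal_def)
    then have "r * x = (r * a) * v $ 1 + (r * b) * v $ 2"
      by (simp add: algebra_simps)
    then show ?thesis
      using * rx mem_entries_ideal[of "r * a" "r * b" v] by simp
  qed
  moreover have "\<exists>d\<in>\<O>. d \<noteq> 0 \<and> (\<forall>x\<in>entries_ideal v. d * x \<in> \<O>)"
  proof -
    obtain i where i: "u $ i \<noteq> 0"
      using uv by (metis integral_splitting_def add_0 mult_zero_left zero_neq_one)
    \<comment> \<open>A nonzero u_i already multiplies the ideal into \<open>\<O>\<close>, but the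
      denominator d must itself be integral.\<close>
    obtain t :: nat where t: "t > 0" "of_nat t * u $ i \<in> \<O>"
      using integral_multiple[OF K] .
    have "of_nat t * u $ i * x \<in> \<O>" if "x \<in> entries_ideal v" for x
      using integral_splitting_mult_entries_ideal[OF uv that, of i] by (simp add: mult.assoc)
    then show ?thesis
      using i t by (intro bexI[of _ "of_nat t * u $ i"]) auto
  qed
  ultimately show "fractional_ideal (entries_ideal v)"
    by (simp add: fractional_ideal_def)
  obtain i where "v $ i \<noteq> 0"
    using uv by (metis integral_splitting_def add_0 mult_zero_right zero_neq_one)
  then show "entries_ideal v \<noteq> {0}"
    using component_in_entries_ideal[of v i] by auto
qed

text \<open>Any x in I equals (u1 x) v1 + (u2 x) v2, with integral coefficients because u1 and u2
  lie in (\<open>\<O>\<close> : I).\<close>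

lemma fractional_ideal_as_entries_ideal:
  fixes I :: "'k::field_char_0 set"
  assumes K: "number_field TYPE('k)" and I: "fractional_ideal I" "I \<noteq> {0}"
  obtains u v where "integral_splitting u v" "entries_ideal v = I"
proof -
  obtain v1 v2 u1 u2 where *: "v1 \<in> I" "v2 \<in> I" "u1 \<in> colon I" "u2 \<in> colon I" "u1 * v1 + u2 * v2 = 1"
    using fractional_ideal_two_generators[OF K I] .
  define u v :: "'k^2" where "u = vector [u1, u2]" and "v = vector [v1, v2]"
  have uv: "u $ 1 = u1" "u $ 2 = u2" "v $ 1 = v1" "v $ 2 = v2"
    by (simp_all add: u_def v_def)
  have "integral_splitting u v"
    using * by (simp add: integral_splitting_def forall_2 uv colon_def)
  moreover have "x \<in> entries_ideal v" if "x \<in> I" for x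
  proof -
    have "x = x * (u1 * v1 + u2 * v2)"
      using *(5) by simp
    also have "\<dots> = (u1 * x) * v $ 1 + (u2 * x) * v $ 2"
      by (simp add: uv algebra_simps)
    also have "\<dots> \<in> entries_ideal v"
      using * that by (intro mem_entries_ideal) (auto simp: colon_def)
    finally show ?thesis .
  qed
  moreover have "entries_ideal v \<subseteq> I"
    using * fractional_idealD[OF I(1)] by (auto simp: entries_ideal_def uv)
  ultimately show thesis
    using that by blast
qed

text \<open>An intertwining matrix maps \<open>u\<close> to a multiple of \<open>u'\<close> and pulls \<open>v'\<close> back to a multiple
  of \<open>v\<close>; conversely, when the ideals agree, the determinant one matrix with
  \<open>v' P = v\<close> that also matches the complementary coordinates is integral.\<close>

lemma split_conjugate_iff:
  fixes chi :: "'c \<Rightarrow> 'k::field_char_0"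
  assumes uv: "integral_splitting u v" "integral_splitting u' v'"
    and g0: "g0 \<in> carrier C" "chi g0 \<noteq> 1"
    and \<phi>: "\<And>g. g \<in> carrier C \<Longrightarrow> \<phi> g = split_matrix u v (chi g)"
    and \<psi>: "\<And>g. g \<in> carrier C \<Longrightarrow> \<psi> g = split_matrix u' v' (chi g)"
  shows "conjugate_in (GL \<O>) C \<phi> \<psi> \<longleftrightarrow> (\<exists>c. c \<noteq> 0 \<and> entries_ideal v' = (\<lambda>x. c * x) ` entries_ideal v)"
proof
  assume "conjugate_in (GL \<O>) C \<phi> \<psi>"
  then obtain P where P: "P \<in> carrier (GL \<O>)" "\<And>g. g \<in> carrier C \<Longrightarrow> \<psi> g ** P = P ** \<phi> g"
    by (auto simp: conjugate_in_GL)
  then obtain B where B: "\<And>i j. P $ i $ j \<in> \<O>" "\<And>i j. B $ i $ j \<in> \<O>" "P ** B = mat 1"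
    by (auto simp: GL_def)
  \<comment> \<open>w is the row v' P and y the column P u. Comparing both sides at g0 and
    cancelling \<open>1 - chi g0\<close> leaves an identity of rank one matrices.\<close>
  define w where "w j = v' $ 1 * P $ 1 $ j + v' $ 2 * P $ 2 $ j" for j
  define y where "y i = P $ i $ 1 * u $ 1 + P $ i $ 2 * u $ 2" for i
  have rank1: "u' $ i * w j = y i * v $ j" for i j
  proof -
    have "(split_matrix u' v' (chi g0) ** P) $ i $ j = (P ** split_matrix u v (chi g0)) $ i $ j"
      using P(2)[OF g0(1)] \<phi>[OF g0(1)] \<psi>[OF g0(1)] by simp
    moreover have "(split_matrix u' v' (chi g0) ** P) $ i $ j =
        (1 - chi g0) * (u' $ i * w j) + chi g0 * P $ i $ j"
      using exhaust_2[of i] by (auto simp: matrix_matrix_mult_def split_matrix_def sum_2 w_def algebra_simps)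
    moreover have "(P ** split_matrix u v (chi g0)) $ i $ j =
        (1 - chi g0) * (y i * v $ j) + chi g0 * P $ i $ j"
      using exhaust_2[of j] by (auto simp: matrix_matrix_mult_def split_matrix_def sum_2 y_def algebra_simps)
    ultimately show ?thesis
      using g0(2) by simp
  qed
  \<comment> \<open>Pairing the rank one identity with v' yields v' P = c v.\<close>
  define c where "c = v' $ 1 * y 1 + v' $ 2 * y 2"
  have w: "w j = c * v $ j" for j
  proof -
    have "w j = (u' $ 1 * v' $ 1 + u' $ 2 * v' $ 2) * w j"
      using uv(2) by (simp add: integral_splitting_def)
    also have "\<dots> = v' $ 1 * (u' $ 1 * w j) + v' $ 2 * (u' $ 2 * w j)"
      by (simp add: algebra_simps)
    also have "\<dots> = c * v $ j"
      unfolding rank1 by (simp add: c_def algebra_simps)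
    finally show ?thesis .
  qed
  have PB: "P $ i $ 1 * B $ 1 $ j + P $ i $ 2 * B $ 2 $ j = (if i = j then 1 else 0)" for i j
    using arg_cong[OF B(3), of "\<lambda>M. M $ i $ j"] by (simp add: matrix_matrix_mult_def sum_2 mat_def)
  \<comment> \<open>Multiplying v' P = c v by B inverts it: this gives c nonzero and one inclusion
    of ideals, the equation itself the other.\<close>
  have v': "v' $ j = c * (B $ 1 $ j * v $ 1 + B $ 2 $ j * v $ 2)" for j
  proof -
    have "c * (B $ 1 $ j * v $ 1 + B $ 2 $ j * v $ 2) = w 1 * B $ 1 $ j + w 2 * B $ 2 $ j"
      by (simp add: w algebra_simps)
    also have "\<dots> = v' $ 1 * (P $ 1 $ 1 * B $ 1 $ j + P $ 1 $ 2 * B $ 2 $ j) +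
        v' $ 2 * (P $ 2 $ 1 * B $ 1 $ j + P $ 2 $ 2 * B $ 2 $ j)"
      by (simp add: w_def algebra_simps)
    also have "\<dots> = v' $ j"
      using exhaust_2[of j] by (auto simp: PB)
    finally show ?thesis by simp
  qed
  have "c \<noteq> 0"
    using v'[of 1] v'[of 2] uv(2) by (auto simp: integral_splitting_def)
  moreover have "entries_ideal v' \<subseteq> (\<lambda>x. c * x) ` entries_ideal v"
  proof
    fix x assume "x \<in> entries_ideal v'"
    then obtain a b where ab: "a \<in> \<O>" "b \<in> \<O>" "x = a * v' $ 1 + b * v' $ 2"
      by (auto simp: entries_ideal_def)
    have "x = c * ((a * B $ 1 $ 1 + b * B $ 1 $ 2) * v $ 1 + (a * B $ 2 $ 1 + b * B $ 2 $ 2) * v $ 2)"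
      unfolding ab(3) v'[of 1] v'[of 2] by (simp add: algebra_simps)
    then show "x \<in> (\<lambda>x. c * x) ` entries_ideal v"
      using ab(1,2) B(2) by (auto intro!: imageI mem_entries_ideal)
  qed
  moreover have "(\<lambda>x. c * x) ` entries_ideal v \<subseteq> entries_ideal v'"
  proof
    fix x assume "x \<in> (\<lambda>x. c * x) ` entries_ideal v"
    then obtain a b where ab: "a \<in> \<O>" "b \<in> \<O>" "x = c * (a * v $ 1 + b * v $ 2)"
      by (auto simp: entries_ideal_def)
    then have "x = a * w 1 + b * w 2"
      by (simp add: w algebra_simps)
    also have "\<dots> = (P $ 1 $ 1 * a + P $ 1 $ 2 * b) * v' $ 1 + (P $ 2 $ 1 * a + P $ 2 $ 2 * b) * v' $ 2"
      by (simp add: w_def algebra_simps)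
    also have "\<dots> \<in> entries_ideal v'"
      using ab(1,2) B(1) by (intro mem_entries_ideal) auto
    finally show "x \<in> entries_ideal v'" .
  qed
  ultimately show "\<exists>c. c \<noteq> 0 \<and> entries_ideal v' = (\<lambda>x. c * x) ` entries_ideal v"
    by blast
next
  assume "\<exists>c. c \<noteq> 0 \<and> entries_ideal v' = (\<lambda>x. c * x) ` entries_ideal v"
  then obtain c where c: "c \<noteq> 0" "entries_ideal v' = entries_ideal (c *s v)"
    by (auto simp: entries_ideal_scale)
  \<comment> \<open>Rescaling leaves the representation unchanged and makes the two ideals equal,
    not merely proportional.\<close>
  define x y where "x = inverse c *s u" and "y = c *s v"
  have xy: "integral_splitting x y"
    using integral_splitting_scale[OF uv(1) c(1)] by (simp add: x_def y_def)
  have \<phi>': "\<phi> g = split_matrix x y (chi g)" if "g \<in> carrier C" for g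
    using \<phi>[OF that] c(1) by (simp add: split_matrix_scale x_def y_def)
  have ideals: "entries_ideal v' = entries_ideal y"
    using c(2) by (simp add: y_def)
  have "transition x y u' v' \<in> carrier (GL \<O>)"
  proof (rule transition_in_GL)
    show "u' $ i * y $ j \<in> \<O>" for i j
      using integral_splitting_mult_entries_ideal[OF uv(2)] component_in_entries_ideal ideals by metis
    show "v' $ i * x $ j \<in> \<O>" for i j
      using integral_splitting_mult_entries_ideal[OF xy] component_in_entries_ideal ideals
      by (metis mult.commute)
  qed (use uv(2) xy in \<open>auto simp: integral_splitting_def\<close>)
  moreover have "\<psi> g ** transition x y u' v' = transition x y u' v' ** \<phi> g" if "g \<in> carrier C" for g
    unfolding \<phi>'[OF that] \<psi>[OF that] using uv(2) xy
    by (intro transition_intertwines) (auto simp: integral_splitting_def)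
  ultimately show "conjugate_in (GL \<O>) C \<phi> \<psi>"
    by (auto simp: conjugate_in_GL)
qed

section \<open>Ideal classes and integral forms\<close>

text \<open>Turns cosets of principal ideals into orbits under scaling.\<close>

lemma ideal_mult_principal:
  assumes "fractional_ideal I"
  shows "ideal_mult ((\<lambda>x. c * x) ` \<O>) I = (\<lambda>x. c * x) ` I"
proof
  show "ideal_mult ((\<lambda>x. c * x) ` \<O>) I \<subseteq> (\<lambda>x. c * x) ` I"
  proof
    fix x assume "x \<in> ideal_mult ((\<lambda>x. c * x) ` \<O>) I"
    then obtain m :: nat and a b where ab: "x = (\<Sum>i<m. a i * b i)"
        "\<forall>i<m. a i \<in> (\<lambda>x. c * x) ` \<O>" "\<forall>i<m. b i \<in> I"
      by (auto simp: ideal_mult_def)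
    have "\<forall>i<m. \<exists>r\<in>\<O>. a i = c * r"
      using ab(2) by auto
    then obtain r where r: "\<And>i. i < m \<Longrightarrow> r i \<in> \<O>" "\<And>i. i < m \<Longrightarrow> a i = c * r i"
      by metis
    have "(\<Sum>i<k. r i * b i) \<in> I" if "k \<le> m" for k
      using that
    proof (induction k)
      case (Suc k)
      then show ?case
        using fractional_idealD(2,3)[OF assms] r(1) ab(3) by simp
    qed (simp add: fractional_idealD(1)[OF assms])
    moreover have "x = c * (\<Sum>i<m. r i * b i)"
      using r(2) by (simp add: ab(1) sum_distrib_left mult.assoc)
    ultimately show "x \<in> (\<lambda>x. c * x) ` I"
      by blast
  qed
  show "(\<lambda>x. c * x) ` I \<subseteq> ideal_mult ((\<lambda>x. c * x) ` \<O>) I"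
  proof
    fix x assume "x \<in> (\<lambda>x. c * x) ` I"
    then obtain y where y: "y \<in> I" "x = c * y" by auto
    then have "x = (\<Sum>i<1::nat. (\<lambda>_. c * 1) i * (\<lambda>_. y) i)"
      by simp
    then show "x \<in> ideal_mult ((\<lambda>x. c * x) ` \<O>) I"
      unfolding ideal_mult_def using y(1) by (intro CollectI exI conjI) (assumption | auto)+
  qed
qed

definition ideal_class :: "'k::field_char_0 set \<Rightarrow> 'k set set"
  where "ideal_class I = {(\<lambda>x. c * x) ` I | c. c \<noteq> 0}"

lemma carrier_class_group:
  "carrier (class_group :: 'k::field_char_0 set set monoid) =
    ideal_class ` {I. fractional_ideal I \<and> I \<noteq> {0}}"
proof -
  have "principal_ideals #>\<^bsub>ideal_group\<^esub> I = ideal_class I" if "fractional_ideal I" for I :: "'k set"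
    using ideal_mult_principal[OF that]
    by (auto simp: r_coset_def ideal_group_def principal_ideals_def ideal_class_def)
  then show ?thesis
    by (auto simp: class_group_def FactGroup_def RCOSETS_def ideal_group_def image_iff)
qed

lemma ideal_class_eq_iff:
  "ideal_class I = ideal_class J \<longleftrightarrow> (\<exists>c. c \<noteq> 0 \<and> J = (\<lambda>x. c * x) ` I)"
proof
  have "(\<lambda>x. 1 * x) ` J \<in> ideal_class J"
    unfolding ideal_class_def by (intro CollectI exI[of _ 1]) simp
  then have "J \<in> ideal_class J"
    by simp
  moreover assume "ideal_class I = ideal_class J"
  ultimately have "J \<in> ideal_class I"
    by simp
  then show "\<exists>c. c \<noteq> 0 \<and> J = (\<lambda>x. c * x) ` I"
    by (auto simp: ideal_class_def)
next
  assume "\<exists>c. c \<noteq> 0 \<and> J = (\<lambda>x. c * x) ` I"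
  then obtain c where c: "c \<noteq> 0" "J = (\<lambda>x. c * x) ` I" by blast
  have "(\<lambda>x. d * x) ` J = (\<lambda>x. (d * c) * x) ` I" for d
    by (simp add: c(2) image_image mult.assoc)
  moreover have "(\<lambda>x. d * x) ` I = (\<lambda>x. (d / c) * x) ` J" for d
    using c(1) by (simp add: c(2) image_image)
  ultimately show "ideal_class I = ideal_class J"
    unfolding ideal_class_def using c(1) by (auto; metis divide_eq_0_iff mult_eq_0_iff)
qed

text \<open>The classes are the fibres of f, one for each value.\<close>

lemma card_quotient_kernel: "card (X // {(x, y) \<in> X \<times> X. f x = f y}) = card (f ` X)"
proof -
  have "{(x, y) \<in> X \<times> X. f x = f y} `` {x} = {y \<in> X. f y = f x}" if "x \<in> X" for x
    using that by auto
  then have "X // {(x, y) \<in> X \<times> X. f x = f y} = (\<lambda>z. {x \<in> X. f x = z}) ` f ` X"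
    by (simp add: quotient_def image_image UNION_singleton_eq_range cong: image_cong)
  moreover have "inj_on (\<lambda>z. {x \<in> X. f x = z}) (f ` X)"
    by (auto simp: inj_on_def)
  ultimately show ?thesis
    by (simp add: card_image)
qed

text \<open>With P conjugating the form to the diagonal one and B inverse to P, the projection is
  the first column of B times the first row of P. Integrality comes from dividing
  \<open>\<phi> g0 - chi g0\<close> by the unit \<open>1 - chi g0\<close>.\<close>

lemma integral_form_split:
  fixes chi :: "'c \<Rightarrow> 'k::field_char_0"
  assumes \<phi>: "\<phi> \<in> integral_forms C (one_plus_char chi)"
    and g0: "g0 \<in> carrier C" "chi g0 \<noteq> 1" "chi g0 \<in> \<O>" "inverse (1 - chi g0) \<in> \<O>"
  obtains u v where "integral_splitting u v" "\<And>g. g \<in> carrier C \<Longrightarrow> \<phi> g = split_matrix u v (chi g)"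
proof -
  obtain P where P: "P \<in> carrier (GL UNIV)"
      "\<And>g. g \<in> carrier C \<Longrightarrow> one_plus_char chi g ** P = P ** \<phi> g"
    using \<phi> by (auto simp: integral_forms_def conjugate_in_GL)
  then obtain B where B: "P ** B = mat 1" "B ** P = mat 1"
    by (auto simp: GL_def)
  define u v :: "'k^2" where "u = (\<chi> i. B $ i $ 1)" and "v = P $ 1"
  have uv1: "u $ 1 * v $ 1 + u $ 2 * v $ 2 = 1"
    using arg_cong[OF B(1), of "\<lambda>M. M $ 1 $ 1"]
    by (simp add: u_def v_def matrix_matrix_mult_def sum_2 mat_def mult.commute)
  have BP: "B $ i $ 2 * P $ 2 $ j = (if i = j then 1 else 0) - u $ i * v $ j" for i j
    using arg_cong[OF B(2), of "\<lambda>M. M $ i $ j"]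
    by (simp add: u_def v_def matrix_matrix_mult_def sum_2 mat_def algebra_simps)
  have split: "\<phi> g = split_matrix u v (chi g)" if g: "g \<in> carrier C" for g
  proof -
    have "\<phi> g = B ** (one_plus_char chi g ** P)"
      using P(2)[OF g] B(2) by (simp add: matrix_mul_assoc)
    then have "\<phi> g $ i $ j = u $ i * v $ j + chi g * (B $ i $ 2 * P $ 2 $ j)" for i j
      by (simp add: u_def v_def matrix_matrix_mult_def sum_2 one_plus_char_def algebra_simps)
    then show ?thesis
      by (simp add: BP split_matrix_def Finite_Cartesian_Product.vec_eq_iff)
  qed
  have "u $ i * v $ j \<in> \<O>" for i j
  proof -
    have "\<phi> g0 \<in> carrier (GL \<O>)"
      using \<phi> g0(1) by (auto simp: integral_forms_def homs_def hom_def)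
    then have "\<phi> g0 $ i $ j \<in> \<O>"
      by (simp add: GL_def)
    then have "inverse (1 - chi g0) * (\<phi> g0 $ i $ j - chi g0 * (if i = j then 1 else 0)) \<in> \<O>"
      using g0(3,4) by simp
    also have "\<phi> g0 $ i $ j - chi g0 * (if i = j then 1 else 0) = (1 - chi g0) * (u $ i * v $ j)"
      by (simp add: split[OF g0(1)] split_matrix_def algebra_simps)
    finally show ?thesis
      using g0(2) by (simp add: mult.assoc[symmetric])
  qed
  then have "integral_splitting u v"
    using uv1 by (simp add: integral_splitting_def)
  then show thesis
    using split by (rule that)
qed

lemma split_is_integral_form:
  fixes chi :: "'c \<Rightarrow> 'k::field_char_0"
  assumes "group C" and chi: "chi \<in> homs C unit_group" and uv: "integral_splitting u v"
    and int: "\<And>g. g \<in> carrier C \<Longrightarrow> chi g \<in> \<O>" "\<And>g. g \<in> carrier C \<Longrightarrow> inverse (chi g) \<in> \<O>"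
  shows "(\<lambda>g\<in>carrier C. split_matrix u v (chi g)) \<in> integral_forms C (one_plus_char chi)"
proof -
  interpret group C by fact
  have uv1: "u $ 1 * v $ 1 + u $ 2 * v $ 2 = 1"
    using uv by (simp add: integral_splitting_def)
  let ?\<phi> = "\<lambda>g\<in>carrier C. split_matrix u v (chi g)"
  have "?\<phi> \<in> hom C (GL \<O>)"
    unfolding hom_def using chi int
    by (auto simp: in_homs_unit_group intro!: split_matrix_in_GL[OF uv])
      (simp add: GL_def split_matrix_mult[OF uv1])
  then have "?\<phi> \<in> homs C (GL \<O>)"
    by (simp add: homs_def)
  moreover have "conjugate_in (GL UNIV) C ?\<phi> (one_plus_char chi)"
    unfolding conjugate_in_GL
  proof (intro bexI ballI)
    show "transition u v (axis 1 1) (axis 1 1) \<in> carrier (GL UNIV)"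
      using uv1 by (intro transition_in_GL) (auto simp: axis_def)
    show "one_plus_char chi g ** transition u v (axis 1 1) (axis 1 1) =
        transition u v (axis 1 1) (axis 1 1) ** ?\<phi> g" if "g \<in> carrier C" for g
      using that uv1 by (simp add: one_plus_char_eq axis_def transition_intertwines)
  qed
  ultimately show ?thesis
    by (simp add: integral_forms_def)
qed

theorem theorem1:
  fixes C :: "('c, 'd) monoid_scheme"
    and chi :: "'c \<Rightarrow> 'k::field_char_0"
    and n :: nat
  assumes "number_field TYPE('k)"
    and "group C" and "cyclic_group C" and "finite (carrier C)"
    and "chi \<in> carrier (character_group C)"
    and "n = group.ord (character_group C) chi"
    and "n > 1" and "\<not> primepow n"
  shows "card (integral_classes C (one_plus_char chi)) = class_number TYPE('k)"
proof -
  note K = assms(1)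
  interpret X: group "character_group C :: ('c \<Rightarrow> 'k) monoid"
    using assms(2) by (rule group_character_group)
  obtain g0 where g0: "g0 \<in> carrier C" "\<And>k. chi g0 ^ k = 1 \<longleftrightarrow> n dvd k"
    using character_generator_order[OF assms(2,3,5,6)] by blast
  have chi: "chi \<in> homs C unit_group"
    using assms(5) by (simp add: character_group_def)
  have pow: "chi g ^ n = 1" if "g \<in> carrier C" for g
  proof -
    have "chi [^]\<^bsub>character_group C\<^esub> n = \<one>\<^bsub>character_group C\<^esub>"
      using assms(5,6) by simp
    then show ?thesis
      unfolding character_group_pow using that
      by (auto simp: character_group_def restrict_def fun_eq_iff split: if_splits)
  qed
  have root_in_O: "z \<in> \<O>" if "z ^ n = 1" for z :: 'k
    using that assms(7) by (intro O_if_power_diff[of z n 0]) auto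
  have int: "chi g \<in> \<O>" "inverse (chi g) \<in> \<O>" if "g \<in> carrier C" for g
    using root_in_O pow[OF that] by (simp_all add: power_inverse)
  have "chi g0 \<noteq> 1"
    using g0(2)[of 1] assms(7) by simp
  moreover have "inverse (1 - chi g0) \<in> \<O>"
    using g0(2) assms(7,8) by (intro one_minus_root_of_unity_is_unit[of _ n]) (auto dest: dvd_imp_le)
  ultimately have unit: "chi g0 \<noteq> 1" "chi g0 \<in> \<O>" "inverse (1 - chi g0) \<in> \<O>"
    using int g0(1) by auto
  define F where "F = integral_forms C (one_plus_char chi)"
  have "\<exists>u v. integral_splitting u v \<and> (\<forall>g\<in>carrier C. \<phi> g = split_matrix u v (chi g))" if "\<phi> \<in> F" for \<phi>
    using integral_form_split[OF that[unfolded F_def] g0(1) unit] by metis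
  \<comment> \<open>A choice of splitting for each form; its ambiguity is a scaling, invisible to
    the ideal class.\<close>
  then obtain U V where UV: "\<And>\<phi>. \<phi> \<in> F \<Longrightarrow> integral_splitting (U \<phi>) (V \<phi>)"
      "\<And>\<phi> g. \<phi> \<in> F \<Longrightarrow> g \<in> carrier C \<Longrightarrow> \<phi> g = split_matrix (U \<phi>) (V \<phi>) (chi g)"
    by metis
  define f where "f \<phi> = ideal_class (entries_ideal (V \<phi>))" for \<phi>
  have conj: "conjugate_in (GL \<O>) C \<phi> \<psi> \<longleftrightarrow> f \<phi> = f \<psi>" if "\<phi> \<in> F" "\<psi> \<in> F" for \<phi> \<psi>
    unfolding f_def ideal_class_eq_iff using UV that g0(1) unit(1) by (intro split_conjugate_iff) auto
  have "f ` F = carrier (class_group :: 'k set set monoid)"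
  proof
    show "f ` F \<subseteq> carrier class_group"
      unfolding carrier_class_group f_def using fractional_entries_ideal[OF K UV(1)] by blast
    show "carrier class_group \<subseteq> f ` F"
    proof
      fix c :: "'k set set" assume "c \<in> carrier class_group"
      then obtain I where I: "fractional_ideal I" "I \<noteq> {0}" "c = ideal_class I"
        unfolding carrier_class_group by blast
      obtain u v where uv: "integral_splitting u v" "entries_ideal v = I"
        using fractional_ideal_as_entries_ideal[OF K I(1,2)] .
      define \<phi> where "\<phi> = (\<lambda>g\<in>carrier C. split_matrix u v (chi g))"
      have \<phi>: "\<phi> \<in> F"
        unfolding F_def \<phi>_def using assms(2) chi uv(1) int by (rule split_is_integral_form)
      \<comment> \<open>The chosen splitting of this form need not be (u, v). Comparing the form
        with itself through both splittings shows that their ideals are proportional.\<close>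
      have "conjugate_in (GL \<O>) C \<phi> \<phi>"
        using conj[OF \<phi> \<phi>] by simp
      then have "\<exists>c. c \<noteq> 0 \<and> entries_ideal (V \<phi>) = (\<lambda>x. c * x) ` entries_ideal v"
        using split_conjugate_iff[where chi = chi and \<phi> = \<phi> and \<psi> = \<phi>, OF uv(1) UV(1)[OF \<phi>] g0(1) unit(1)] UV(2)[OF \<phi>]
        by (simp add: \<phi>_def)
      then have "c = f \<phi>"
        unfolding f_def I(3) ideal_class_eq_iff uv(2) .
      then show "c \<in> f ` F"
        using \<phi> by blast
    qed
  qed
  moreover have "integral_classes C (one_plus_char chi) = F // {(\<phi>, \<psi>) \<in> F \<times> F. f \<phi> = f \<psi>}"
    unfolding integral_classes_def F_def[symmetric] using conj by (intro arg_cong2[of _ _ _ _ quotient]) auto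
  ultimately show ?thesis
    by (simp only: card_quotient_kernel class_number_def Coset.order_def)
qed

end
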